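(* Fix $n\in\mathbb{N}$, constants $\lambda>0$, a weight sequence $w_1,\dots,w_n>0$, and $p\in[1,\infty]$. For $d\ge 1$ let $G_{\mathrm{GIRG}}=\mathrm{GIRG}(\{w\}_1^n,d)$ be the standard GIRG with $L_p$-norm and let $G_{\mathrm{IRG}}=\mathrm{IRG}(\{w\}_1^n)$, both regarded as random elements of the finite set $\mathcal{G}(n)$ of all graphs on the vertex set $\{1,\dots,n\}$. Then $$\lim_{d\to\infty}\|G_{\mathrm{GIRG}},G_{\mathrm{IRG}}\|_{\mathrm{TV}}=0.$$
   Context: IRG: each pair $\{u,v\}$ of distinct vertices is an edge independently with probability $\min\{1,\lambda w_uw_v/n\}$. Standard GIRG with $L_p$-norm and fixed weights: each vertex $v$ gets independently a position $\mathbf{x}_v$ uniform on the torus $\mathbb{T}^d=[0,1)^d$ (coordinates taken mod 1); the distance is $\|\mathbf{x}_u-\mathbf{x}_v\|_p$ computed from the coordinatewise circle distances $|x_{ui}-x_{vi}|_C=\min\{|x_{ui}-x_{vi}|,1-|x_{ui}-x_{vi}|\}$ (for $p=\infty$ this is $\max_i|x_{ui}-x_{vi}|_C$); two distinct vertices $u,v$ are adjacent iff their distance is at most a threshold $t_{uv}$, chosen so that $\Pr[u\sim v]=\min\{1,\lambda w_uw_v/n\}$ (for $p=\infty$, $t_{uv}=\frac12(\lambda w_uw_v/n)^{1/d}$). The total variation distance of two random graphs $G_1,G_2$ with values in $\mathcal{G}(n)$ is $\|G_1,G_2\|_{\mathrm{TV}}=\frac12\sum_{H\in\mathcal{G}(n)}|\Pr[G_1=H]-\Pr[G_2=H]|$.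 *)

theory Defs
  imports "HOL-Probability.Probability"
begin

text \<open>
  A graph on the vertex set \<open>{1..n}\<close> is represented by its set of edges, each edge being a
  two-element set of vertices.
\<close>

definition vertex_pairs :: "nat \<Rightarrow> nat set set" where
  "vertex_pairs n = {{u, v} | u v. u \<in> {1..n} \<and> v \<in> {1..n} \<and> u \<noteq> v}"

definition graphs :: "nat \<Rightarrow> nat set set set" where
  "graphs n = Pow (vertex_pairs n)"

definition edge_prob :: "nat \<Rightarrow> real \<Rightarrow> (nat \<Rightarrow> real) \<Rightarrow> nat \<Rightarrow> nat \<Rightarrow> real" where
  "edge_prob n lam w u v = min 1 (lam * w u * w v / real n)"

text \<open>
  The family of coin flips is indexed by the unordered pairs \<open>e = {u, v}\<close>, for which
  \<open>edge_prob n lam w (Min e) (Max e)\<close> is the (symmetric) edge probability of \<open>u\<close> and \<open>v\<close>.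
\<close>

definition irg :: "nat \<Rightarrow> real \<Rightarrow> (nat \<Rightarrow> real) \<Rightarrow> nat set set pmf" where
  "irg n lam w =
     map_pmf (\<lambda>b. {e \<in> vertex_pairs n. b e})
       (Pi_pmf (vertex_pairs n) False
         (\<lambda>e. bernoulli_pmf (edge_prob n lam w (Min e) (Max e))))"

definition torus_uniform :: "nat \<Rightarrow> (nat \<Rightarrow> real) measure" where
  "torus_uniform d = PiM {..<d} (\<lambda>_. uniform_measure lborel {0..<1})"

definition positions :: "nat \<Rightarrow> nat \<Rightarrow> (nat \<Rightarrow> nat \<Rightarrow> real) measure" where
  "positions n d = PiM {1..n} (\<lambda>_. torus_uniform d)"

definition circle_dist :: "real \<Rightarrow> real \<Rightarrow> real" where
  "circle_dist a b = min \<bar>a - b\<bar> (1 - \<bar>a - b\<bar>)"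

definition torus_dist :: "nat \<Rightarrow> ereal \<Rightarrow> (nat \<Rightarrow> real) \<Rightarrow> (nat \<Rightarrow> real) \<Rightarrow> real" where
  "torus_dist d p x y =
     (if p = \<infinity> then Max ((\<lambda>i. circle_dist (x i) (y i)) ` {..<d})
      else (\<Sum>i<d. circle_dist (x i) (y i) powr real_of_ereal p) powr (1 / real_of_ereal p))"

text \<open>
  Thresholds are characterised by the marginal edge probabilities they produce. They need not be
  unique, but any two choices give almost surely the same graph. For \<open>p = \<infinity>\<close> and \<open>u \<noteq> v\<close> one such
  choice is \<open>t u v = (lam * w u * w v / n) powr (1 / d) / 2\<close>.
\<close>

definition girg_thresholds ::
  "nat \<Rightarrow> real \<Rightarrow> (nat \<Rightarrow> real) \<Rightarrow> ereal \<Rightarrow> nat \<Rightarrow> (nat \<Rightarrow> nat \<Rightarrow> real) \<Rightarrow> bool" where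
  "girg_thresholds n lam w p d t \<longleftrightarrow>
     (\<forall>u\<in>{1..n}. \<forall>v\<in>{1..n}. u \<noteq> v \<longrightarrow>
        t u v = t v u \<and>
        measure (positions n d) {x \<in> space (positions n d). torus_dist d p (x u) (x v) \<le> t u v}
          = edge_prob n lam w u v)"

definition girg_graph ::
  "nat \<Rightarrow> ereal \<Rightarrow> nat \<Rightarrow> (nat \<Rightarrow> nat \<Rightarrow> real) \<Rightarrow> (nat \<Rightarrow> nat \<Rightarrow> real) \<Rightarrow> nat set set" where
  "girg_graph n p d t x =
     {{u, v} | u v. u \<in> {1..n} \<and> v \<in> {1..n} \<and> u \<noteq> v \<and> torus_dist d p (x u) (x v) \<le> t u v}"

definition girg ::
  "nat \<Rightarrow> ereal \<Rightarrow> nat \<Rightarrow> (nat \<Rightarrow> nat \<Rightarrow> real) \<Rightarrow> nat set set measure" where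
  "girg n p d t = distr (positions n d) (count_space (graphs n)) (girg_graph n p d t)"

definition tv_dist :: "nat \<Rightarrow> nat set set measure \<Rightarrow> nat set set measure \<Rightarrow> real" where
  "tv_dist n P Q = 1 / 2 * (\<Sum>H\<in>graphs n. \<bar>measure P {H} - measure Q {H}\<bar>)"

end

theory Submission
  imports Defs
begin

text \<open>
  The contribution of one coordinate to the distance of \<open>u\<close> and \<open>v\<close> depends only on the circle
  distance of two uniform points. By translation invariance the circle distances belonging to two
  different pairs are independent, even if the pairs share a vertex; only triples of pairs can be
  dependent.

  For \<open>p < \<infinity>\<close> the standardized sums over the coordinates are therefore uncorrelated, so every linear
  combination satisfies the central limit theorem with the variance of independent summands and the
  joint characteristic function factorizes in the limit. To pass to probabilities one replaces the
  factors \<open>exp (i \<theta> S)\<close> by indicators of \<open>S \<le> \<tau>\<close> one pair at a time, applying Levy's continuity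
  theorem to the law of \<open>S\<close> under a tilted measure.

  For \<open>p = \<infinity>\<close> the probability that all pairs in \<open>A\<close> are adjacent is the \<open>d\<close>-th power of its value in a
  single coordinate. There each non-adjacency has probability \<open>O(1 / d)\<close>, so by pairwise independence
  and Bonferroni the deviation from the product is \<open>O(1 / d\<^sup>2)\<close>, which vanishes after taking the
  \<open>d\<close>-th power.

  In both cases the probability that a set of pairs consists of edges converges to the product of
  the edge probabilities, which determines the limit law of the graph.
\<close>

section \<open>Asymptotic independence from characteristic functions\<close>

lemma isCont_cdf_std_normal: "isCont (cdf std_normal_distribution) x"
proof -
  interpret N: real_distribution std_normal_distribution by (rule real_dist_normal_dist)
  have "emeasure std_normal_distribution {x} = 0"
    by (simp add: emeasure_density nn_integral_indicator_singleton')
  then show ?thesis by (simp add: N.isCont_cdf measure_def)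
qed

text \<open>\<open>V d\<close> is a probability density, and \<open>D d\<close> is the law of
  \<open>S d\<close> under the measure tilted by it. The cosine hypothesis with arbitrary phase
  \<open>b\<close> encodes the real and imaginary parts of the characteristic function of
  \<open>D d\<close>, so Levy's theorem applies. It yields convergence at every level because the
  normal cdf is continuous.\<close>

lemma (in prob_space) weighted_cdf_tendsto_std_normal:
  fixes S V :: "nat \<Rightarrow> 'a \<Rightarrow> real"
  assumes [measurable]: "\<And>d. random_variable borel (S d)" "\<And>d. random_variable borel (V d)"
    and V: "\<And>d x. 0 \<le> V d x" "\<And>d x. V d x \<le> B" "\<And>d. expectation (V d) = 1"
    and lim: "\<And>s b. (\<lambda>d. expectation (\<lambda>x. V d x * cos (s * S d x + b)))
      \<longlonglongrightarrow> cos b * exp (- s\<^sup>2 / 2)"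
  shows "(\<lambda>d. expectation (\<lambda>x. V d x * indicator {..\<tau>} (S d x)))
    \<longlonglongrightarrow> cdf std_normal_distribution \<tau>"
proof -
  define D where "D d = distr (density M (\<lambda>x. ennreal (V d x))) borel (S d)" for d
  have int: "integrable M (\<lambda>x. V d x * f x)"
    if [measurable]: "f \<in> borel_measurable M" and "\<And>x. \<bar>f x\<bar> \<le> 1" for f :: "'a \<Rightarrow> real" and d
  proof (rule integrable_const_bound[where B = B])
    have "\<bar>V d x\<bar> * \<bar>f x\<bar> \<le> B * 1" for x
      using V(1,2)[of d x] that(2)[of x] by (intro mult_mono) auto
    then show "AE x in M. norm (V d x * f x) \<le> B" by (simp add: abs_mult)
  qed simp
  have prob: "prob_space (density M (\<lambda>x. ennreal (V d x)))" for d
  proof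
    have "(\<integral>\<^sup>+ x. ennreal (V d x) \<partial>M) = ennreal (expectation (V d))"
      using int[of "\<lambda>_. 1" d] V(1) by (intro nn_integral_eq_integral) auto
    then show "emeasure (density M (\<lambda>x. ennreal (V d x))) (space (density M (\<lambda>x. ennreal (V d x)))) = 1"
      using V(3) by (simp add: emeasure_density cong: nn_integral_cong)
  qed
  have D: "real_distribution (D d)" for d
    using prob_space.real_distribution_distr[OF prob, of "S d"] by (simp add: D_def)
  \<comment> \<open>Since \<open>cos (y - pi / 2) = sin y\<close>, the phases \<open>0\<close> and
    \<open>- (pi / 2)\<close> produce the real and the imaginary part.\<close>
  have char: "char (D d) s = complex_of_real (expectation (\<lambda>x. V d x * cos (s * S d x + 0)))
      + \<i> * complex_of_real (expectation (\<lambda>x. V d x * cos (s * S d x + - (pi / 2))))" for d s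
  proof -
    have "char (D d) s = (CLINT x|M. V d x *\<^sub>R iexp (s * S d x))"
      by (simp add: char_def D_def integral_distr integral_density V(1))
    also have "\<dots> = (CLINT x|M. complex_of_real (V d x * cos (s * S d x + 0))
        + \<i> * complex_of_real (V d x * cos (s * S d x + - (pi / 2))))"
      by (intro Bochner_Integration.integral_cong)
         (auto simp: complex_eq_iff Re_exp Im_exp cos_diff)
    also have "\<dots> = (CLINT x|M. complex_of_real (V d x * cos (s * S d x + 0)))
        + (CLINT x|M. \<i> * complex_of_real (V d x * cos (s * S d x + - (pi / 2))))"
      by (intro Bochner_Integration.integral_add integrable_mult_right integrable_of_real int) auto
    finally show ?thesis
      by (simp only: integral_complex_of_real Bochner_Integration.integral_mult_right_zero)
  qed
  have "(\<lambda>d. char (D d) s) \<longlonglongrightarrow>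
      complex_of_real (cos 0 * exp (- s\<^sup>2 / 2)) + \<i> * complex_of_real (cos (- (pi / 2)) * exp (- s\<^sup>2 / 2))" for s
    unfolding char by (intro tendsto_intros lim)
  then have "weak_conv_m D std_normal_distribution"
    by (intro levy_continuity D real_dist_normal_dist) (simp add: char_std_normal_distribution)
  then have "(\<lambda>d. cdf (D d) \<tau>) \<longlonglongrightarrow> cdf std_normal_distribution \<tau>"
    using isCont_cdf_std_normal by (simp add: weak_conv_m_def weak_conv_def)
  moreover have "cdf (D d) \<tau> = expectation (\<lambda>x. V d x * indicator {..\<tau>} (S d x))" for d
  proof -
    interpret D: real_distribution "D d" by (rule D)
    have "cdf (D d) \<tau> = (\<integral>x. indicator {..\<tau>} x \<partial>D d)"
      by (simp add: cdf_def)
    also have "\<dots> = expectation (\<lambda>x. V d x * indicator {..\<tau>} (S d x))"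
      unfolding D_def by (subst integral_distr, simp, simp, subst integral_density) (simp_all add: V(1))
    finally show ?thesis .
  qed
  ultimately show ?thesis by simp
qed

lemma (in prob_space) expectation_mult_indicator_tendsto:
  fixes S W :: "nat \<Rightarrow> 'a \<Rightarrow> real"
  assumes [measurable]: "\<And>d. random_variable borel (S d)" "\<And>d. random_variable borel (W d)"
    and W: "\<And>d x. \<bar>W d x\<bar> \<le> 1"
    and limS: "\<And>s b. (\<lambda>d. expectation (\<lambda>x. cos (s * S d x + b))) \<longlonglongrightarrow> cos b * exp (- s\<^sup>2 / 2)"
    and limW: "\<And>s b. (\<lambda>d. expectation (\<lambda>x. W d x * cos (s * S d x + b)))
      \<longlonglongrightarrow> c * (cos b * exp (- s\<^sup>2 / 2))"
  shows "(\<lambda>d. expectation (\<lambda>x. W d x * indicator {..\<tau>} (S d x)))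
    \<longlonglongrightarrow> c * cdf std_normal_distribution \<tau>"
proof -
  \<comment> \<open>Tilting by the positive density \<open>V = 1 + (W - E W) / 2\<close> reduces the signed weight \<open>W\<close> to
    Levy's theorem for probability measures.\<close>
  define m where "m d = expectation (W d)" for d
  define V where "V d x = 1 + (W d x - m d) / 2" for d x
  have intW: "integrable M (\<lambda>x. W d x * f x)"
    if [measurable]: "f \<in> borel_measurable M" and "\<And>x. \<bar>f x\<bar> \<le> 1" for f :: "'a \<Rightarrow> real" and d
  proof (rule integrable_const_bound[where B = 1])
    have "\<bar>W d x\<bar> * \<bar>f x\<bar> \<le> 1 * 1" for x
      using W[of d x] that(2)[of x] by (intro mult_mono) auto
    then show "AE x in M. norm (W d x * f x) \<le> 1" by (simp add: abs_mult)
  qed simp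
  have m: "\<bar>m d\<bar> \<le> 1" for d
  proof -
    have i: "integrable M (W d)" using intW[of "\<lambda>_. 1" d] by simp
    have "\<bar>m d\<bar> \<le> expectation (\<lambda>x. \<bar>W d x\<bar>)"
      unfolding m_def by (rule integral_abs_bound)
    also have "\<dots> \<le> expectation (\<lambda>x. 1)"
      using W i by (intro integral_mono) auto
    finally show ?thesis by (simp add: prob_space)
  qed
  \<comment> \<open>At \<open>s = b = 0\<close> the hypothesis identifies \<open>c\<close> as the
    limit of the means of \<open>W\<close>.\<close>
  have limm: "m \<longlonglongrightarrow> c"
    using limW[of 0 0] by (simp add: m_def[abs_def])
  have V[measurable]: "random_variable borel (V d)" for d unfolding V_def by simp
  have split: "expectation (\<lambda>x. V d x * f x)
      = expectation f + (expectation (\<lambda>x. W d x * f x) - m d * expectation f) / 2"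
    if [measurable]: "f \<in> borel_measurable M" and f: "\<And>x. \<bar>f x\<bar> \<le> 1" for f :: "'a \<Rightarrow> real" and d
  proof -
    have i: "integrable M f"
      using f by (intro integrable_const_bound[where B = 1]) auto
    note j = intW[OF that, of d]
    have "expectation (\<lambda>x. V d x * f x) = expectation (\<lambda>x. f x + (W d x * f x - m d * f x) / 2)"
      by (intro Bochner_Integration.integral_cong) (auto simp: V_def field_simps)
    also have "\<dots> = expectation f + (expectation (\<lambda>x. W d x * f x) - m d * expectation f) / 2"
      using i j by simp
    finally show ?thesis .
  qed
  have "(\<lambda>d. expectation (\<lambda>x. V d x * indicator {..\<tau>} (S d x)))
    \<longlonglongrightarrow> cdf std_normal_distribution \<tau>"
  proof (rule weighted_cdf_tendsto_std_normal[where B = 2])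
    show "0 \<le> V d x" "V d x \<le> 2" for d x
      using W[of d x] m[of d] by (auto simp: V_def abs_le_iff field_simps)
    show "expectation (V d) = 1" for d
      using split[of "\<lambda>_. 1" d] by (simp add: prob_space m_def)
    fix s b
    have "(\<lambda>d. expectation (\<lambda>x. cos (s * S d x + b))
        + (expectation (\<lambda>x. W d x * cos (s * S d x + b)) - m d * expectation (\<lambda>x. cos (s * S d x + b))) / 2)
      \<longlonglongrightarrow> cos b * exp (- s\<^sup>2 / 2) + (c * (cos b * exp (- s\<^sup>2 / 2)) - c * (cos b * exp (- s\<^sup>2 / 2))) / 2"
      by (intro tendsto_intros limS limW limm) simp
    then show "(\<lambda>d. expectation (\<lambda>x. V d x * cos (s * S d x + b))) \<longlonglongrightarrow> cos b * exp (- s\<^sup>2 / 2)"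
      by (subst split) auto
  qed simp_all
  moreover have cdfS: "(\<lambda>d. expectation (\<lambda>x. indicator {..\<tau>} (S d x))) \<longlonglongrightarrow> cdf std_normal_distribution \<tau>"
    using weighted_cdf_tendsto_std_normal[of S "\<lambda>_ _. 1" 1 \<tau>] limS by (simp add: prob_space)
  \<comment> \<open>Undo the tilting: pointwise \<open>W = 2 * (V - 1) + m\<close>. The term in
    brackets tends to 0 because the tilted and the untilted law have the same limit, so only the
    mean contributes.\<close>
  ultimately have "(\<lambda>d. 2 * (expectation (\<lambda>x. V d x * indicator {..\<tau>} (S d x))
        - expectation (\<lambda>x. indicator {..\<tau>} (S d x)))
        + m d * expectation (\<lambda>x. indicator {..\<tau>} (S d x)))
      \<longlonglongrightarrow> 2 * (cdf std_normal_distribution \<tau> - cdf std_normal_distribution \<tau>)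
        + c * cdf std_normal_distribution \<tau>"
    by (intro tendsto_intros limm)
  then show ?thesis
    by (subst (asm) split) (auto simp: field_simps)
qed

text \<open>Approximation replaces attainment because \<open>q = 1\<close> occurs for capped edge
  probabilities and no real level reaches it. Values between the tails come from the intermediate
  value theorem, values near 0 or 1 from the tails themselves.\<close>

lemma std_normal_cdf_approximates:
  fixes q e :: real
  assumes "0 \<le> q" "q \<le> 1" "0 < e"
  shows "\<exists>\<tau>. \<bar>cdf std_normal_distribution \<tau> - q\<bar> < e"
proof -
  interpret N: real_distribution std_normal_distribution by (rule real_dist_normal_dist)
  let ?F = "cdf std_normal_distribution"
  have "eventually (\<lambda>x. ?F x < e) at_bot" "eventually (\<lambda>x. 1 - e < ?F x) at_top"
    using order_tendstoD(2)[OF N.cdf_lim_at_bot, of e] order_tendstoD(1)[OF N.cdf_lim_at_top_prob, of "1 - e"] assms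
    by auto
  then obtain a b where a: "?F a < e" and b: "1 - e < ?F b" 
    by (meson eventually_at_bot_linorder eventually_at_top_linorder order_refl)
  show ?thesis
  proof (cases "?F a \<le> q \<and> q \<le> ?F b")
    case True
    show ?thesis
    proof (cases "a \<le> b")
      case True
      then obtain x where "?F x = q"
        using IVT[of ?F a q b] \<open>?F a \<le> q \<and> q \<le> ?F b\<close> isCont_cdf_std_normal by auto
      then show ?thesis using assms by (intro exI[of _ x]) simp
    next
      case False
      then have "?F b \<le> ?F a" by (intro N.cdf_nondecreasing) simp
      then show ?thesis using True assms by (intro exI[of _ a]) auto
    qed
  next
    case False
    then show ?thesis
    proof (cases "?F a \<le> q")
      case True
      then show ?thesis using False b assms by (intro exI[of _ b]) auto
    next
      case f: False
      then show ?thesis using a assms by (intro exI[of _ a]) auto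
    qed
  qed
qed

text \<open>The limit for fixed levels extends to levels \<open>\<tau> d\<close> known only through the probabilities
  \<open>q\<close> they produce, because indicators of two nested half-lines differ in mean by the difference of
  their probabilities.\<close>

lemma (in prob_space) expectation_mult_quantile_tendsto:
  fixes S W :: "nat \<Rightarrow> 'a \<Rightarrow> real"
  assumes [measurable]: "\<And>d. random_variable borel (S d)" "\<And>d. random_variable borel (W d)"
    and W: "\<And>d x. \<bar>W d x\<bar> \<le> 1"
    and limS: "\<And>s b. (\<lambda>d. expectation (\<lambda>x. cos (s * S d x + b))) \<longlonglongrightarrow> cos b * exp (- s\<^sup>2 / 2)"
    and limW: "\<And>s b. (\<lambda>d. expectation (\<lambda>x. W d x * cos (s * S d x + b)))
      \<longlonglongrightarrow> c * (cos b * exp (- s\<^sup>2 / 2))"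
    and q: "0 \<le> q" "q \<le> 1" "\<forall>\<^sub>F d in sequentially. prob {x \<in> space M. S d x \<le> \<tau> d} = q"
  shows "(\<lambda>d. expectation (\<lambda>x. W d x * indicator {..\<tau> d} (S d x))) \<longlonglongrightarrow> c * q"
proof (rule tendstoI)
  fix e :: real assume "0 < e"
  \<comment> \<open>The final error consists of \<open>2 * e'\<close> from the limits at the fixed
    level \<open>r\<close> and \<open>\<bar>c\<bar> * e'\<close> from replacing \<open>?F\<close> by
    \<open>q\<close>; with this choice the total is \<open>e / 2\<close>.\<close>
  define e' where "e' = e / (4 + 2 * \<bar>c\<bar>)"
  have "0 < e'" using \<open>0 < e\<close> by (simp add: e'_def)
  have ee: "(2 + \<bar>c\<bar>) * e' < e"
    using \<open>0 < e\<close> by (simp add: e'_def field_simps add_nonneg_pos)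
  obtain r where r: "\<bar>cdf std_normal_distribution r - q\<bar> < e'"
    using std_normal_cdf_approximates[OF q(1,2) \<open>0 < e'\<close>] by blast
  let ?F = "cdf std_normal_distribution r"
  let ?P = "\<lambda>t d. expectation (\<lambda>x. indicator {..t} (S d x) :: real)"
  let ?E = "\<lambda>t d. expectation (\<lambda>x. W d x * indicator {..t} (S d x))"
  have limE: "?E r \<longlonglongrightarrow> c * ?F"
    by (rule expectation_mult_indicator_tendsto) (use W limS limW in auto)
  have limP: "?P r \<longlonglongrightarrow> ?F"
    using expectation_mult_indicator_tendsto[of S "\<lambda>_ _. 1" 1 r] limS by simp
  have Pq: "?P t d = prob {x \<in> space M. S d x \<le> t}" for t d
  proof -
    have "?P t d = expectation (indicator {x \<in> space M. S d x \<le> t})"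
      by (intro Bochner_Integration.integral_cong) (auto split: split_indicator)
    then show ?thesis by simp
  qed
  have diff: "\<bar>?E t d - ?E r d\<bar> \<le> \<bar>?P t d - ?P r d\<bar>" for t d
  proof -
    let ?i = "\<lambda>t x. indicator {..t} (S d x) :: real"
    have iW: "integrable M (\<lambda>x. W d x * ?i t x)" for t
    proof (rule integrable_const_bound[where B = 1])
      have "\<bar>W d x\<bar> * \<bar>?i t x\<bar> \<le> 1 * 1" for x
        using W[of d x] by (intro mult_mono) (auto split: split_indicator)
      then show "AE x in M. norm (W d x * ?i t x) \<le> 1" by (simp add: abs_mult)
    qed simp
    have ii: "integrable M (?i t)" for t
      by (intro integrable_const_bound[where B = 1]) (auto split: split_indicator)
    have "\<bar>?E t d - ?E r d\<bar> = \<bar>expectation (\<lambda>x. W d x * (?i t x - ?i r x))\<bar>"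
      using iW by (simp add: right_diff_distrib)
    also have "\<dots> \<le> expectation (\<lambda>x. \<bar>W d x * (?i t x - ?i r x)\<bar>)"
      by (rule integral_abs_bound)
    also have "\<dots> \<le> expectation (\<lambda>x. \<bar>?i t x - ?i r x\<bar>)"
    proof (rule integral_mono)
      show "integrable M (\<lambda>x. \<bar>W d x * (?i t x - ?i r x)\<bar>)"
        using iW by (auto simp: right_diff_distrib)
      show "integrable M (\<lambda>x. \<bar>?i t x - ?i r x\<bar>)" using ii by auto
      show "\<bar>W d x * (?i t x - ?i r x)\<bar> \<le> \<bar>?i t x - ?i r x\<bar>" for x
        using mult_right_mono[OF W[of d x], of "\<bar>?i t x - ?i r x\<bar>"] by (simp add: abs_mult)
    qed
    also have "\<dots> = \<bar>?P t d - ?P r d\<bar>"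
    proof (cases "t \<le> r")
      case True
      then have "expectation (\<lambda>x. \<bar>?i t x - ?i r x\<bar>) = expectation (\<lambda>x. ?i r x - ?i t x)"
        by (intro Bochner_Integration.integral_cong) (auto split: split_indicator)
      moreover have "?P t d \<le> ?P r d"
        using True ii by (intro integral_mono) (auto split: split_indicator)
      ultimately show ?thesis using ii by simp
    next
      case False
      then have "expectation (\<lambda>x. \<bar>?i t x - ?i r x\<bar>) = expectation (\<lambda>x. ?i t x - ?i r x)"
        by (intro Bochner_Integration.integral_cong) (auto split: split_indicator)
      moreover have "?P r d \<le> ?P t d"
        using False ii by (intro integral_mono) (auto split: split_indicator)
      ultimately show ?thesis using ii by simp
    qed
    finally show ?thesis .
  qed
  have "(\<lambda>d. \<bar>q - ?P r d\<bar> + \<bar>?E r d - c * ?F\<bar>) \<longlonglongrightarrow> \<bar>q - ?F\<bar> + \<bar>c * ?F - c * ?F\<bar>"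
    by (intro tendsto_intros limE limP)
  then have "\<forall>\<^sub>F d in sequentially. \<bar>q - ?P r d\<bar> + \<bar>?E r d - c * ?F\<bar> < 2 * e'"
    using r \<open>0 < e'\<close> by (intro order_tendstoD(2)) auto
  with q(3) show "\<forall>\<^sub>F d in sequentially. dist (?E (\<tau> d) d) (c * q) < e"
  proof eventually_elim
    case (elim d)
    have "\<bar>c * ?F - c * q\<bar> \<le> \<bar>c\<bar> * e'"
      using r by (simp flip: right_diff_distrib add: abs_mult mult_left_mono)
    moreover have "\<bar>?E (\<tau> d) d - ?E r d\<bar> \<le> \<bar>q - ?P r d\<bar>"
      using diff[of d "\<tau> d"] elim(1) by (simp add: Pq)
    ultimately have "\<bar>?E (\<tau> d) d - c * q\<bar> < 2 * e' + \<bar>c\<bar> * e'"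
      using elim(2) by linarith
    then show ?case using ee by (simp add: dist_real_def distrib_right)
  qed
qed

text \<open>The limit of the joint characteristic function is that of independent standard normals.
  Indicators are introduced one index at a time, each time treating the product of the earlier
  indicators with a cosine as a bounded weight for the next variable.\<close>

lemma (in prob_space) asymptotically_independent_levels:
  fixes S :: "nat \<Rightarrow> 'e \<Rightarrow> 'a \<Rightarrow> real"
  assumes "finite E"
    and [measurable]: "\<And>d e. e \<in> E \<Longrightarrow> random_variable borel (S d e)"
    and lim: "\<And>\<theta> b. (\<lambda>d. expectation (\<lambda>x. cos ((\<Sum>e\<in>E. \<theta> e * S d e x) + b)))
      \<longlonglongrightarrow> cos b * exp (- (\<Sum>e\<in>E. (\<theta> e)\<^sup>2) / 2)"
    and q: "\<And>e. e \<in> E \<Longrightarrow> 0 \<le> q e" "\<And>e. e \<in> E \<Longrightarrow> q e \<le> 1"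
      "\<And>e. e \<in> E \<Longrightarrow> \<forall>\<^sub>F d in sequentially. prob {x \<in> space M. S d e x \<le> \<tau> d e} = q e"
    and "A \<subseteq> E"
  shows "(\<lambda>d. prob {x \<in> space M. \<forall>e\<in>A. S d e x \<le> \<tau> d e}) \<longlonglongrightarrow> (\<Prod>e\<in>A. q e)"
proof -
  let ?I = "\<lambda>A d x. \<Prod>e\<in>A. indicator {..\<tau> d e} (S d e x) :: real"
  let ?L = "\<lambda>\<theta> d x. \<Sum>e\<in>E. \<theta> e * S d e x"
  have L: "?L \<theta> d \<in> borel_measurable M" for \<theta> d by measurable
  have I: "?I A d \<in> borel_measurable M" if "A \<subseteq> E" for A d
    using that by (intro borel_measurable_prod) auto
  have I1: "\<bar>?I A d x\<bar> \<le> 1" for A d x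
    by (simp add: abs_prod) (intro prod_le_1, auto split: split_indicator)
  have L_upd: "?L (\<theta>(e := s)) d x = ?L \<theta> d x + s * S d e x" if "e \<in> E" "\<theta> e = 0" for \<theta> e s d x
  proof -
    have "?L (\<theta>(e := s)) d x = (\<Sum>e'\<in>E. \<theta> e' * S d e' x + (if e' = e then s * S d e x else 0))"
      using that by (intro sum.cong) auto
    then show ?thesis using that \<open>finite E\<close> by (simp add: sum.distrib)
  qed
  have sq_upd: "(\<Sum>e'\<in>E. ((\<theta>(e := s)) e')\<^sup>2) = (\<Sum>e'\<in>E. (\<theta> e')\<^sup>2) + s\<^sup>2" if "e \<in> E" "\<theta> e = 0" for \<theta> e and s :: real
  proof -
    have "(\<Sum>e'\<in>E. ((\<theta>(e := s)) e')\<^sup>2) = (\<Sum>e'\<in>E. (\<theta> e')\<^sup>2 + (if e' = e then s\<^sup>2 else 0))"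
      using that by (intro sum.cong) auto
    then show ?thesis using that \<open>finite E\<close> by (simp add: sum.distrib)
  qed
  \<comment> \<open>The induction invariant mixes indicators on \<open>A\<close> with a cosine of a
    linear form supported off \<open>A\<close>. Since \<open>\<theta>\<close> and \<open>b\<close>
    are arbitrary, the coefficient of the next index is free to serve as the argument of its
    characteristic function.\<close>
  have step: "(\<lambda>d. expectation (\<lambda>x. ?I A d x * cos (?L \<theta> d x + b)))
      \<longlonglongrightarrow> (\<Prod>e\<in>A. q e) * (cos b * exp (- (\<Sum>e\<in>E. (\<theta> e)\<^sup>2) / 2))"
    if "A \<subseteq> E" "\<And>e. e \<in> A \<Longrightarrow> \<theta> e = 0" for A \<theta> b
    using finite_subset[OF \<open>A \<subseteq> E\<close> \<open>finite E\<close>] that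
  proof (induction A arbitrary: \<theta> b rule: finite_induct)
    case empty
    show ?case using lim by simp
  next
    case (insert a A)
    have a: "a \<in> E" "\<theta> a = 0" and A: "A \<subseteq> E" using insert.prems by auto
    note [measurable] = L I[OF A]
    have Sa[measurable]: "random_variable borel (S d a)" for d using a by simp
    let ?c = "(\<Prod>e\<in>A. q e) * (cos b * exp (- (\<Sum>e\<in>E. (\<theta> e)\<^sup>2) / 2))"
    have "(\<lambda>d. expectation (\<lambda>x. (?I A d x * cos (?L \<theta> d x + b)) * indicator {..\<tau> d a} (S d a x)))
      \<longlonglongrightarrow> ?c * q a"
    proof (rule expectation_mult_quantile_tendsto)
      show "\<bar>?I A d x * cos (?L \<theta> d x + b)\<bar> \<le> 1" for d x
        using mult_mono[OF I1 abs_cos_le_one] by (simp add: abs_mult)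
      show "(\<lambda>d. expectation (\<lambda>x. cos (s * S d a x + b'))) \<longlonglongrightarrow> cos b' * exp (- s\<^sup>2 / 2)" for s b'
        using lim[of "(\<lambda>_. 0)(a := s)" b'] L_upd[of a "\<lambda>_. 0" s] sq_upd[of a "\<lambda>_. 0" s] a by simp
      fix s b'
      let ?\<theta> = "\<lambda>s. \<theta>(a := s)"
      have z: "(?\<theta> s) e = 0" if "e \<in> A" for e s
        using that insert.hyps insert.prems(2)[of e] by auto
      have i: "integrable M (\<lambda>x. ?I A d x * cos (?L (?\<theta> s) d x + b))" for d s b
      proof (rule integrable_const_bound[where B = 1])
        show "AE x in M. norm (?I A d x * cos (?L (?\<theta> s) d x + b)) \<le> 1"
          using mult_mono[OF I1 abs_cos_le_one] by (simp add: abs_mult)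
      qed (use A in measurable)
      \<comment> \<open>The product-to-sum formula turns the two cosines into single ones, with
        coefficient \<open>s\<close> or \<open>- s\<close> at \<open>a\<close>; both are instances
        of the induction hypothesis, since \<open>a\<close> is not in \<open>A\<close>.\<close>
      have eq: "expectation (\<lambda>x. ?I A d x * cos (?L \<theta> d x + b) * cos (s * S d a x + b'))
        = (expectation (\<lambda>x. ?I A d x * cos (?L (?\<theta> s) d x + (b + b')))
          + expectation (\<lambda>x. ?I A d x * cos (?L (?\<theta> (- s)) d x + (b - b')))) / 2" for d
      proof -
        have "expectation (\<lambda>x. ?I A d x * cos (?L \<theta> d x + b) * cos (s * S d a x + b'))
          = expectation (\<lambda>x. (?I A d x * cos (?L (?\<theta> s) d x + (b + b'))
             + ?I A d x * cos (?L (?\<theta> (- s)) d x + (b - b'))) / 2)"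
        proof (intro Bochner_Integration.integral_cong refl)
          fix x
          have "cos (?L (?\<theta> s) d x + (b + b')) = cos ((?L \<theta> d x + b) + (s * S d a x + b'))"
            "cos (?L (?\<theta> (- s)) d x + (b - b')) = cos ((?L \<theta> d x + b) - (s * S d a x + b'))"
            using L_upd[of a \<theta>] a by (simp_all add: algebra_simps)
          then show "?I A d x * cos (?L \<theta> d x + b) * cos (s * S d a x + b')
            = (?I A d x * cos (?L (?\<theta> s) d x + (b + b')) + ?I A d x * cos (?L (?\<theta> (- s)) d x + (b - b'))) / 2"
            by (simp only: cos_add cos_diff) (simp add: field_simps)
        qed
        also have "\<dots> = (expectation (\<lambda>x. ?I A d x * cos (?L (?\<theta> s) d x + (b + b')))
          + expectation (\<lambda>x. ?I A d x * cos (?L (?\<theta> (- s)) d x + (b - b')))) / 2"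
          using i by (subst integral_divide_zero, subst Bochner_Integration.integral_add) auto
        finally show ?thesis .
      qed
      let ?Q = "\<Prod>e\<in>A. q e" and ?s = "\<Sum>e\<in>E. (\<theta> e)\<^sup>2"
      have "(\<lambda>d. expectation (\<lambda>x. ?I A d x * cos (?L \<theta> d x + b) * cos (s * S d a x + b')))
        \<longlonglongrightarrow> (?Q * (cos (b + b') * exp (- (\<Sum>e\<in>E. (?\<theta> s e)\<^sup>2) / 2))
          + ?Q * (cos (b - b') * exp (- (\<Sum>e\<in>E. (?\<theta> (- s) e)\<^sup>2) / 2))) / 2"
        unfolding eq by (intro tendsto_intros insert.IH A z) auto
      also have "(?Q * (cos (b + b') * exp (- (\<Sum>e\<in>E. (?\<theta> s e)\<^sup>2) / 2))
          + ?Q * (cos (b - b') * exp (- (\<Sum>e\<in>E. (?\<theta> (- s) e)\<^sup>2) / 2))) / 2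
        = ?Q * exp (- (?s + s\<^sup>2) / 2) * ((cos (b + b') + cos (b - b')) / 2)"
        using a by (simp only: sq_upd) (simp add: field_simps)
      also have "exp (- (?s + s\<^sup>2) / 2) = exp (- ?s / 2) * exp (- s\<^sup>2 / 2)"
        by (simp add: exp_add[symmetric] add_divide_distrib)
      also have "(cos (b + b') + cos (b - b')) / 2 = cos b * cos b'"
        by (simp add: cos_add cos_diff)
      finally show "(\<lambda>d. expectation (\<lambda>x. ?I A d x * cos (?L \<theta> d x + b) * cos (s * S d a x + b')))
        \<longlonglongrightarrow> ?c * (cos b' * exp (- s\<^sup>2 / 2))"
        by (simp add: mult_ac)
    qed (use a q in auto)
    then show ?case using insert.hyps by (simp add: mult_ac)
  qed
  \<comment> \<open>With \<open>\<theta> = 0\<close> and \<open>b = 0\<close> the cosine is 1 and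
    only the indicators remain.\<close>
  have "(\<lambda>d. expectation (\<lambda>x. ?I A d x)) \<longlonglongrightarrow> (\<Prod>e\<in>A. q e)"
    using step[of A "\<lambda>_. 0" 0] \<open>A \<subseteq> E\<close> by simp
  moreover have "expectation (\<lambda>x. ?I A d x) = prob {x \<in> space M. \<forall>e\<in>A. S d e x \<le> \<tau> d e}" for d
  proof -
    have f: "finite A" using \<open>A \<subseteq> E\<close> \<open>finite E\<close> by (rule finite_subset)
    have "expectation (\<lambda>x. ?I A d x) = expectation (indicator {x \<in> space M. \<forall>e\<in>A. S d e x \<le> \<tau> d e})"
    proof (intro Bochner_Integration.integral_cong refl)
      fix x assume "x \<in> space M"
      then show "?I A d x = indicator {x \<in> space M. \<forall>e\<in>A. S d e x \<le> \<tau> d e} x"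
        using f by (auto simp: indicator_def)
    qed
    also have "\<dots> = prob {x \<in> space M. \<forall>e\<in>A. S d e x \<le> \<tau> d e}"
      by (simp, rule arg_cong[where f = prob]) auto
    finally show ?thesis .
  qed
  ultimately show ?thesis by simp
qed

section \<open>Circle distances of uniform points\<close>

abbreviation unit_uniform :: "real measure" where
  "unit_uniform \<equiv> uniform_measure lborel {0..<1}"

lemma unit_uniform_eq_density: "unit_uniform = density lborel (indicator {0..<1})"
  by (auto simp: uniform_measure_def divide_ennreal_def intro!: arg_cong[where f = "density lborel"])

lemma prob_space_unit_uniform: "prob_space unit_uniform"
  by (rule prob_space_uniform_measure) auto

lemma sets_unit_uniform [measurable_cong]: "sets unit_uniform = sets borel"
  by simp

lemma AE_unit_uniform: "AE x in unit_uniform. x \<in> {0..<1}"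
  by (rule AE_uniform_measureI) auto

lemma integral_unit_uniform:
  fixes g :: "real \<Rightarrow> real"
  assumes [measurable]: "g \<in> borel_measurable borel"
  shows "integral\<^sup>L unit_uniform g = (\<integral>y. indicator {0..<1} y * g y \<partial>lborel)"
  unfolding unit_uniform_eq_density ennreal_indicator[symmetric]
  by (subst integral_density) auto

lemma measurable_frac_real [measurable]: "(frac :: real \<Rightarrow> real) \<in> borel_measurable borel"
  unfolding frac_def by measurable

text \<open>Rotation of the circle by \<open>a\<close> exchanges two intervals: with
  \<open>k = frac a\<close>, it moves \<open>[k, 1)\<close> onto \<open>[0, 1 - k)\<close> and
  \<open>[0, k)\<close> onto \<open>[1 - k, 1)\<close>, each by a translation, which preserves
  Lebesgue measure.\<close>

lemma integral_unit_uniform_shift: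
  fixes g :: "real \<Rightarrow> real"
  assumes [measurable]: "g \<in> borel_measurable borel" and g: "\<And>y. \<bar>g y\<bar> \<le> B"
  shows "(\<integral>y. g (frac (y - a)) \<partial>unit_uniform) = integral\<^sup>L unit_uniform g"
proof -
  define k where "k = frac a"
  have k: "0 \<le> k" "k < 1" by (auto simp: k_def frac_lt_1)
  have shift: "frac (y - a) = (if k \<le> y then y - k else y - k + 1)" if "y \<in> {0..<1}" for y
  proof -
    have "y - a - (if k \<le> y then y - k else y - k + 1) = of_int (if k \<le> y then - \<lfloor>a\<rfloor> else - \<lfloor>a\<rfloor> - 1)"
      by (auto simp: k_def frac_def)
    then have "y - a - (if k \<le> y then y - k else y - k + 1) \<in> \<int>" by (metis Ints_of_int)
    then show ?thesis using that k by (subst frac_unique_iff) auto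
  qed
  have int: "integrable lborel (\<lambda>y. indicator {a..<b} y * h y)"
    if [measurable]: "h \<in> borel_measurable borel" and "\<And>y. \<bar>h y\<bar> \<le> B" for a b and h :: "real \<Rightarrow> real"
    using integrableI_bounded_set_indicator[of "{a..<b}" lborel h B] that by (cases "a \<le> b") auto
  have "(\<integral>y. g (frac (y - a)) \<partial>unit_uniform) = (\<integral>y. indicator {0..<1} y * g (frac (y - a)) \<partial>lborel)"
    by (rule integral_unit_uniform) simp
  also have "\<dots> = (\<integral>y. indicator {k..<1} y * g (y - k) + indicator {0..<k} y * g (y - k + 1) \<partial>lborel)"
    using k shift by (intro Bochner_Integration.integral_cong) (auto split: split_indicator)
  also have "\<dots> = (\<integral>y. indicator {k..<1} y * g (y - k) \<partial>lborel) + (\<integral>y. indicator {0..<k} y * g (y - k + 1) \<partial>lborel)"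
    using g by (intro Bochner_Integration.integral_add int) auto
  also have "(\<integral>y. indicator {k..<1} y * g (y - k) \<partial>lborel) = (\<integral>y. indicator {0..<1 - k} y * g y \<partial>lborel)"
    by (subst (2) lborel_integral_real_affine[where c = 1 and t = "- k"], simp)
       (auto intro!: Bochner_Integration.integral_cong split: split_indicator)
  also have "(\<integral>y. indicator {0..<k} y * g (y - k + 1) \<partial>lborel) = (\<integral>y. indicator {1 - k..<1} y * g y \<partial>lborel)"
    by (subst (2) lborel_integral_real_affine[where c = 1 and t = "1 - k"], simp)
       (auto intro!: Bochner_Integration.integral_cong simp: algebra_simps split: split_indicator)
  also have "(\<integral>y. indicator {0..<1 - k} y * g y \<partial>lborel) + (\<integral>y. indicator {1 - k..<1} y * g y \<partial>lborel)
    = (\<integral>y. indicator {0..<1 - k} y * g y + indicator {1 - k..<1} y * g y \<partial>lborel)"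
    using g by (intro Bochner_Integration.integral_add[symmetric] int) auto
  also have "\<dots> = (\<integral>y. indicator {0..<1} y * g y \<partial>lborel)"
    using k by (intro Bochner_Integration.integral_cong) (auto split: split_indicator)
  also have "\<dots> = integral\<^sup>L unit_uniform g"
    by (rule integral_unit_uniform[symmetric]) simp
  finally show ?thesis .
qed

text \<open>A periodic form of \<open>circle_dist\<close>: the two agree on \<open>[0,1)\<close>, but this one is bounded and
  translation invariant on the whole line, which is the space of \<open>unit_uniform\<close>.\<close>

definition circle_gap :: "real \<Rightarrow> real \<Rightarrow> real" where
  "circle_gap a b = min (frac (a - b)) (1 - frac (a - b))"

lemma circle_gap_bounds: "0 \<le> circle_gap a b" "circle_gap a b \<le> 1 / 2"
  using frac_ge_0[of "a - b"] frac_lt_1[of "a - b"] by (auto simp: circle_gap_def min_def)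

lemma circle_gap_commute: "circle_gap a b = circle_gap b a"
proof (cases "a - b \<in> \<int>")
  case True
  then have "frac (a - b) = 0" "frac (b - a) = 0"
    using Ints_minus[OF True] by simp_all
  then show ?thesis unfolding circle_gap_def by (simp only:)
next
  case False
  then show ?thesis using frac_neg[of "a - b"] by (simp add: circle_gap_def min.commute)
qed

lemma circle_gap_eq_circle_dist:
  assumes "a \<in> {0..<1}" "b \<in> {0..<1}"
  shows "circle_gap a b = circle_dist a b"
proof -
  have "frac (a - b) = (if b \<le> a then a - b else a - b + 1)"
    using assms by (subst frac_unique_iff) auto
  then show ?thesis using assms by (auto simp: circle_gap_def circle_dist_def)
qed

lemma measurable_circle_gap [measurable]:
  assumes [measurable]: "f \<in> borel_measurable M" "g \<in> borel_measurable M"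
  shows "(\<lambda>x. circle_gap (f x) (g x)) \<in> borel_measurable M"
  unfolding circle_gap_def by measurable

text \<open>Rotation invariance moves the centre \<open>a\<close> to 0. The bound on
  \<open>g\<close> is requested only on \<open>[0, 1/2]\<close>, the range of the gap, so that
  powers, which are unbounded on the line, are admissible.\<close>

lemma integral_circle_gap:
  fixes g :: "real \<Rightarrow> real"
  assumes [measurable]: "g \<in> borel_measurable borel"
    and g: "\<And>z. 0 \<le> z \<Longrightarrow> z \<le> 1 / 2 \<Longrightarrow> \<bar>g z\<bar> \<le> B"
  shows "(\<integral>y. g (circle_gap y a) \<partial>unit_uniform) = (\<integral>y. g (circle_gap y 0) \<partial>unit_uniform)"
proof -
  let ?h = "\<lambda>s. g (min (frac s) (1 - frac s))"
  have "\<bar>?h s\<bar> \<le> B" for s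
    using g circle_gap_bounds[of s 0] by (simp add: circle_gap_def)
  moreover have "?h \<in> borel_measurable borel" by measurable
  ultimately have "(\<integral>y. ?h (frac (y - a)) \<partial>unit_uniform) = integral\<^sup>L unit_uniform ?h" for a
    by (intro integral_unit_uniform_shift)
  then show ?thesis by (simp add: circle_gap_def)
qed

text \<open>Integrate over the position of \<open>v\<close> first: \<open>h\<close> is constant in
  it, and the inner integral of \<open>g\<close> does not depend on the position of \<open>a\<close>
  by rotation invariance. This is the source of pairwise independence, including for pairs that
  share the vertex \<open>a\<close>.\<close>

lemma integral_circle_gap_mult:
  fixes g :: "real \<Rightarrow> real" and h :: "('i \<Rightarrow> real) \<Rightarrow> real"
  assumes I: "finite I" "v \<in> I" "a \<in> I" "a \<noteq> v"
    and [measurable]: "g \<in> borel_measurable borel" "h \<in> borel_measurable (PiM I (\<lambda>_. unit_uniform))"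
    and g: "\<And>z. 0 \<le> z \<Longrightarrow> z \<le> 1 / 2 \<Longrightarrow> \<bar>g z\<bar> \<le> B"
    and h: "\<And>x. \<bar>h x\<bar> \<le> B'" "\<And>x y. h (x(v := y)) = h x"
  shows "(\<integral>x. g (circle_gap (x v) (x a)) * h x \<partial>PiM I (\<lambda>_. unit_uniform))
    = (\<integral>y. g (circle_gap y 0) \<partial>unit_uniform) * (\<integral>x. h x \<partial>PiM I (\<lambda>_. unit_uniform))"
proof -
  interpret U: prob_space unit_uniform by (rule prob_space_unit_uniform)
  interpret product_prob_space "\<lambda>_. unit_uniform" I by unfold_locales
  interpret P: prob_space "PiM I (\<lambda>_. unit_uniform)" by (rule prob_space_PiM) (rule prob_space_unit_uniform)
  define J where "J = I - {v}"
  have J: "I = insert v J" "finite J" "v \<notin> J" "a \<in> J" using I by (auto simp: J_def)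
  let ?G = "\<integral>y. g (circle_gap y 0) \<partial>unit_uniform"
  have [measurable]: "(\<lambda>x. x v) \<in> borel_measurable (PiM I (\<lambda>_. unit_uniform))"
    "(\<lambda>x. x a) \<in> borel_measurable (PiM I (\<lambda>_. unit_uniform))"
    using measurable_component_singleton[OF I(2), of "\<lambda>_. unit_uniform"]
      measurable_component_singleton[OF I(3), of "\<lambda>_. unit_uniform"]
    by (simp_all cong: measurable_cong_sets)
  have i1: "integrable (PiM I (\<lambda>_. unit_uniform)) (\<lambda>x. g (circle_gap (x v) (x a)) * h x)"
  proof (rule P.integrable_const_bound[where B = "B * B'"])
    have "\<bar>g (circle_gap (x v) (x a))\<bar> * \<bar>h x\<bar> \<le> B * B'" for x
      using g[of "circle_gap (x v) (x a)"] h(1)[of x] circle_gap_bounds[of "x v" "x a"] by (intro mult_mono) auto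
    then show "AE x in PiM I (\<lambda>_. unit_uniform). norm (g (circle_gap (x v) (x a)) * h x) \<le> B * B'"
      by (simp add: abs_mult)
  qed simp
  have i2: "integrable (PiM I (\<lambda>_. unit_uniform)) h"
    using h(1) by (intro P.integrable_const_bound[where B = B']) auto
  have "(\<integral>x. g (circle_gap (x v) (x a)) * h x \<partial>PiM I (\<lambda>_. unit_uniform))
    = (\<integral>x. (\<integral>y. g (circle_gap y (x a)) * h x \<partial>unit_uniform) \<partial>PiM J (\<lambda>_. unit_uniform))"
    using i1 unfolding J(1) by (subst product_integral_insert[OF J(2,3)]) (auto simp: h(2) I(4))
  also have "\<dots> = (\<integral>x. ?G * h x \<partial>PiM J (\<lambda>_. unit_uniform))"
  proof (intro Bochner_Integration.integral_cong refl)
    show "(\<integral>y. g (circle_gap y (x a)) * h x \<partial>unit_uniform) = ?G * h x" for x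
      using integral_circle_gap[of g B "x a"] g by simp
  qed
  also have "\<dots> = ?G * (\<integral>x. h x \<partial>PiM J (\<lambda>_. unit_uniform))" by simp
  also have "(\<integral>x. h x \<partial>PiM J (\<lambda>_. unit_uniform)) = (\<integral>x. h x \<partial>PiM I (\<lambda>_. unit_uniform))"
    using i2 unfolding J(1) by (subst product_integral_insert[OF J(2,3)]) (auto simp: h(2) U.prob_space)
  finally show ?thesis .
qed

section \<open>Gaps of vertex pairs in a single coordinate\<close>

definition edge_gap :: "nat set \<Rightarrow> (nat \<Rightarrow> real) \<Rightarrow> real" where
  "edge_gap e x = circle_gap (x (Min e)) (x (Max e))"

lemma edge_gap_pair: "edge_gap {u, v} x = circle_gap (x u) (x v)" for u v :: nat
  by (cases "u \<le> v") (auto simp: edge_gap_def circle_gap_commute max_def min_def)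

lemma edge_gap_bounds: "0 \<le> edge_gap e x" "edge_gap e x \<le> 1 / 2"
  unfolding edge_gap_def by (rule circle_gap_bounds)+

lemma vertex_pairsE:
  assumes "e \<in> vertex_pairs n"
  obtains u v where "e = {u, v}" "u \<in> {1..n}" "v \<in> {1..n}" "u < v" "Min e = u" "Max e = v"
proof -
  from assms obtain a b where ab: "e = {a, b}" "a \<in> {1..n}" "b \<in> {1..n}" "a \<noteq> b"
    by (auto simp: vertex_pairs_def)
  then consider "a < b" | "b < a" by linarith
  then show thesis
  proof cases
    case 1
    then show ?thesis using ab that[of a b] by auto
  next
    case 2
    then show ?thesis using ab that[of b a] by (auto simp: insert_commute)
  qed
qed

lemma finite_vertex_pairs: "finite (vertex_pairs n)"
  by (rule finite_subset[of _ "Pow {1..n}"]) (auto simp: vertex_pairs_def)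

abbreviation layer_space :: "nat \<Rightarrow> (nat \<Rightarrow> real) measure" where
  "layer_space n \<equiv> PiM {1..n} (\<lambda>_. unit_uniform)"

lemma prob_space_layer_space: "prob_space (layer_space n)"
  by (rule prob_space_PiM) (rule prob_space_unit_uniform)

lemma measurable_edge_gap [measurable]:
  assumes "e \<in> vertex_pairs n"
  shows "edge_gap e \<in> borel_measurable (layer_space n)"
proof -
  from assms obtain u v where e: "u \<in> {1..n}" "v \<in> {1..n}" "e = {u, v}" by (blast elim: vertex_pairsE)
  have [measurable]: "(\<lambda>x. x u) \<in> borel_measurable (layer_space n)" "(\<lambda>x. x v) \<in> borel_measurable (layer_space n)"
    using measurable_component_singleton[OF e(1), of "\<lambda>_. unit_uniform"]
      measurable_component_singleton[OF e(2), of "\<lambda>_. unit_uniform"]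
    by (simp_all cong: measurable_cong_sets)
  show ?thesis unfolding e(3) edge_gap_pair by measurable
qed

text \<open>All pairs have the same one-coordinate law, namely that of the gap between a uniform
  point and 0; this is the product formula with the constant factor 1.\<close>

lemma integral_edge_gap:
  fixes g :: "real \<Rightarrow> real"
  assumes e: "e \<in> vertex_pairs n" and g: "g \<in> borel_measurable borel"
    "\<And>z. 0 \<le> z \<Longrightarrow> z \<le> 1 / 2 \<Longrightarrow> \<bar>g z\<bar> \<le> B"
  shows "(\<integral>x. g (edge_gap e x) \<partial>layer_space n) = (\<integral>y. g (circle_gap y 0) \<partial>unit_uniform)"
proof -
  interpret prob_space "layer_space n" by (rule prob_space_layer_space)
  from e obtain u v where e: "u \<in> {1..n}" "v \<in> {1..n}" "e = {u, v}" "u < v" by (blast elim: vertex_pairsE)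
  show ?thesis
    using integral_circle_gap_mult[of "{1..n}" u v g "\<lambda>_. 1" B 1] e g by (simp add: edge_gap_pair prob_space del: One_nat_def)
qed

lemma integral_edge_gap_mult:
  fixes g h :: "real \<Rightarrow> real"
  assumes e: "e \<in> vertex_pairs n" "e' \<in> vertex_pairs n" "e \<noteq> e'"
    and g: "g \<in> borel_measurable borel" "\<And>z. 0 \<le> z \<Longrightarrow> z \<le> 1 / 2 \<Longrightarrow> \<bar>g z\<bar> \<le> B"
    and h: "h \<in> borel_measurable borel" "\<And>z. 0 \<le> z \<Longrightarrow> z \<le> 1 / 2 \<Longrightarrow> \<bar>h z\<bar> \<le> B'"
  shows "(\<integral>x. g (edge_gap e x) * h (edge_gap e' x) \<partial>layer_space n)
    = (\<integral>y. g (circle_gap y 0) \<partial>unit_uniform) * (\<integral>y. h (circle_gap y 0) \<partial>unit_uniform)"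
proof -
  \<comment> \<open>Some endpoint \<open>v\<close> of \<open>e\<close> is not in \<open>e'\<close>; integrating over its position first decouples \<open>e\<close>.\<close>
  from e(1) obtain a b where ab: "a \<in> {1..n}" "b \<in> {1..n}" "e = {a, b}" "a < b" by (blast elim: vertex_pairsE)
  from e(2) obtain c d where cd: "c \<in> {1..n}" "d \<in> {1..n}" "e' = {c, d}" "c < d" by (blast elim: vertex_pairsE)
  obtain v u where vu: "v \<in> {1..n}" "u \<in> {1..n}" "u \<noteq> v" "e = {v, u}" "v \<notin> e'"
  proof (cases "a \<in> e'")
    case True
    then have "b \<notin> e'" using ab cd e(3) by auto
    then show ?thesis using that[of b a] ab by (auto simp: insert_commute)
  next
    case False
    then show ?thesis using that[of a b] ab by auto
  qed
  have "(\<integral>x. g (circle_gap (x v) (x u)) * h (edge_gap e' x) \<partial>layer_space n)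
    = (\<integral>y. g (circle_gap y 0) \<partial>unit_uniform) * (\<integral>x. h (edge_gap e' x) \<partial>layer_space n)"
  proof (rule integral_circle_gap_mult[where B = B and B' = B'])
    show "\<bar>h (edge_gap e' x)\<bar> \<le> B'" for x using h edge_gap_bounds by blast
    show "h (edge_gap e' (x(v := y))) = h (edge_gap e' x)" for x y
      using vu(5) cd by (simp add: edge_gap_pair)
    show "(\<lambda>x. h (edge_gap e' x)) \<in> borel_measurable (layer_space n)"
      using measurable_edge_gap[OF e(2)] h(1) by (rule measurable_compose)
  qed (use vu g in auto)
  then show ?thesis using integral_edge_gap[OF e(2) h] vu(4) by (simp add: edge_gap_pair)
qed

section \<open>Independent layers of coordinates\<close>

text \<open>The coordinate \<open>(v, i)\<close> is the \<open>i\<close>-th coordinate of vertex \<open>v\<close>. All dimensions live on this one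
  space, so that the central limit theorem applies to the single i.i.d. sequence of layers.\<close>

abbreviation coord_space :: "(nat \<times> nat \<Rightarrow> real) measure" where
  "coord_space \<equiv> PiM UNIV (\<lambda>_. unit_uniform)"

definition layer :: "nat \<Rightarrow> nat \<Rightarrow> (nat \<times> nat \<Rightarrow> real) \<Rightarrow> nat \<Rightarrow> real" where
  "layer n i \<omega> = (\<lambda>v\<in>{1..n}. \<omega> (v, i))"

interpretation coord: prob_space coord_space
  by (rule prob_space_PiM) (rule prob_space_unit_uniform)

lemma measurable_layer [measurable]: "layer n i \<in> coord_space \<rightarrow>\<^sub>M layer_space n"
  unfolding layer_def by measurable

lemma distr_layer: "distr coord_space (layer_space n) (layer n i) = layer_space n"
  unfolding layer_def[abs_def]
  by (rule distr_PiM_reindex[where f = "\<lambda>v. (v, i)" and M = "\<lambda>_. unit_uniform"])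
     (auto intro: prob_space_unit_uniform simp: inj_on_def)

lemma indep_coords: "coord.indep_vars (\<lambda>_. unit_uniform) (\<lambda>k \<omega>. \<omega> k) UNIV"
proof -
  have "distr coord_space coord_space (\<lambda>\<omega>. \<lambda>k\<in>UNIV. \<omega> k) = coord_space"
    by (simp add: restrict_UNIV distr_id)
  also have "\<dots> = PiM UNIV (\<lambda>k. distr coord_space unit_uniform (\<lambda>\<omega>. \<omega> k))"
    by (intro PiM_cong refl distr_PiM_component[symmetric, where M = "\<lambda>_. unit_uniform"] prob_space_unit_uniform) auto
  finally show ?thesis
    by (subst coord.indep_vars_iff_distr_eq_PiM') auto
qed

text \<open>Distinct layers read disjoint blocks \<open>?K i\<close> of independent coordinates.
  Each block is then reindexed by the vertex alone, so that all layers take values in the same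
  space, as an i.i.d. sequence requires.\<close>

lemma indep_layers: "coord.indep_vars (\<lambda>_. layer_space n) (layer n) UNIV"
proof -
  let ?K = "\<lambda>i. {1..n} \<times> {i}"
  have "coord.indep_vars (\<lambda>i. PiM (?K i) (\<lambda>_. unit_uniform)) (\<lambda>i \<omega>. restrict (\<lambda>k. \<omega> k) (?K i)) UNIV"
    by (rule coord.indep_vars_restrict[OF indep_coords]) (auto simp: disjoint_family_on_def)
  then have "coord.indep_vars (\<lambda>_. layer_space n)
      (\<lambda>i \<omega>. (\<lambda>v\<in>{1..n}. restrict (\<lambda>k. \<omega> k) (?K i) (v, i))) UNIV"
    by (rule coord.indep_vars_compose2[where Y = "\<lambda>i x. \<lambda>v\<in>{1..n}. x (v, i)"])
       (intro measurable_restrict measurable_component_singleton, simp)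
  also have "(\<lambda>i \<omega>. (\<lambda>v\<in>{1..n}. restrict (\<lambda>k. \<omega> k) (?K i) (v, i))) = layer n"
    by (auto simp: layer_def fun_eq_iff)
  finally show ?thesis .
qed

text \<open>Grouping the same coordinates by vertex instead of by layer recovers the positions in
  dimension \<open>d\<close>; this links the common coordinate space with the given model.\<close>

lemma distr_coord_positions:
  "distr coord_space (positions n d) (\<lambda>\<omega>. \<lambda>v\<in>{1..n}. \<lambda>i\<in>{..<d}. \<omega> (v, i)) = positions n d"
proof (cases "n = 0")
  \<comment> \<open>The product characterization of independence is used for a nonempty index set.
    For \<open>n = 0\<close> both sides are probability measures on a one-point space.\<close>
  case True
  let ?P = "positions n d"
  have P: "prob_space ?P" unfolding positions_def torus_uniform_def
    by (intro prob_space_PiM prob_space_unit_uniform)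
  have m: "(\<lambda>\<omega>. \<lambda>v\<in>{1..n}. \<lambda>i\<in>{..<d}. \<omega> (v, i)) \<in> coord_space \<rightarrow>\<^sub>M ?P"
    unfolding positions_def torus_uniform_def by measurable
  show ?thesis
  proof (rule measure_eqI)
    fix A assume "A \<in> sets (distr coord_space ?P (\<lambda>\<omega>. \<lambda>v\<in>{1..n}. \<lambda>i\<in>{..<d}. \<omega> (v, i)))"
    then have "A = {} \<or> A = space ?P" using True by (auto simp: positions_def space_PiM sets_PiM_empty)
    then show "emeasure (distr coord_space ?P (\<lambda>\<omega>. \<lambda>v\<in>{1..n}. \<lambda>i\<in>{..<d}. \<omega> (v, i))) A = emeasure ?P A"
      using prob_space.emeasure_space_1[OF P]
        prob_space.emeasure_space_1[OF coord.prob_space_distr[OF m]] by auto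
  qed simp
next
  case False
  let ?K = "\<lambda>v. {v} \<times> {..<d}"
  let ?X = "\<lambda>v \<omega>. \<lambda>i\<in>{..<d}. \<omega> (v, i)"
  have "coord.indep_vars (\<lambda>v. PiM (?K v) (\<lambda>_. unit_uniform)) (\<lambda>v \<omega>. restrict (\<lambda>k. \<omega> k) (?K v)) {1..n}"
    by (rule coord.indep_vars_restrict[OF indep_coords]) (auto simp: disjoint_family_on_def)
  then have "coord.indep_vars (\<lambda>_. torus_uniform d)
      (\<lambda>v \<omega>. (\<lambda>i\<in>{..<d}. restrict (\<lambda>k. \<omega> k) (?K v) (v, i))) {1..n}"
    unfolding torus_uniform_def
    by (rule coord.indep_vars_compose2[where Y = "\<lambda>v x. \<lambda>i\<in>{..<d}. x (v, i)"])
       (intro measurable_restrict measurable_component_singleton, simp)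
  also have "(\<lambda>v \<omega>. (\<lambda>i\<in>{..<d}. restrict (\<lambda>k. \<omega> k) (?K v) (v, i))) = ?X"
    by (auto simp: fun_eq_iff)
  finally have "distr coord_space (PiM {1..n} (\<lambda>_. torus_uniform d)) (\<lambda>\<omega>. \<lambda>v\<in>{1..n}. ?X v \<omega>)
      = PiM {1..n} (\<lambda>v. distr coord_space (torus_uniform d) (?X v))"
    using False by (subst (asm) coord.indep_vars_iff_distr_eq_PiM') (auto simp: torus_uniform_def)
  also have "\<dots> = PiM {1..n} (\<lambda>_. torus_uniform d)"
  proof (rule PiM_cong[OF refl])
    show "distr coord_space (torus_uniform d) (?X v) = torus_uniform d" for v
      unfolding torus_uniform_def
      by (rule distr_PiM_reindex[where f = "\<lambda>i. (v, i)" and M = "\<lambda>_. unit_uniform"])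
         (auto intro: prob_space_unit_uniform simp: inj_on_def)
  qed
  finally show ?thesis by (simp add: positions_def)
qed

lemma measurable_edge_gap_layer [measurable]:
  assumes "e \<in> vertex_pairs n"
  shows "(\<lambda>\<omega>. edge_gap e (layer n i \<omega>)) \<in> borel_measurable coord_space"
  by (rule measurable_compose[OF measurable_layer measurable_edge_gap[OF assms]])

text \<open>A linear combination of the \<open>S d e\<close> is a normalized sum of the i.i.d.
  variables \<open>F (layer n i \<omega>)\<close>, so the one-dimensional central limit theorem
  suffices. Its variance involves only two pairs at a time, hence pairwise independence gives
  \<open>T\<close>, the sum of the squared coefficients, and dependent triples have no
  effect.\<close>

lemma layer_sums_char_tendsto:
  fixes g :: "real \<Rightarrow> real" and \<theta> :: "nat set \<Rightarrow> real" and n :: nat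
  assumes g: "g \<in> borel_measurable borel" "\<And>z. 0 \<le> z \<Longrightarrow> z \<le> 1 / 2 \<Longrightarrow> \<bar>g z\<bar> \<le> B"
    and mean: "(\<integral>y. g (circle_gap y 0) \<partial>unit_uniform) = 0"
    and var: "(\<integral>y. (g (circle_gap y 0))\<^sup>2 \<partial>unit_uniform) = 1"
  defines "S \<equiv> \<lambda>d e \<omega>. (\<Sum>i<d. g (edge_gap e (layer n i \<omega>))) / sqrt (real d)"
  shows "(\<lambda>d. coord.expectation (\<lambda>\<omega>. cos ((\<Sum>e\<in>vertex_pairs n. \<theta> e * S d e \<omega>) + b)))
    \<longlonglongrightarrow> cos b * exp (- (\<Sum>e\<in>vertex_pairs n. (\<theta> e)\<^sup>2) / 2)"
proof -
  let ?E = "vertex_pairs n"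
  note fin = finite_vertex_pairs[of n]
  interpret N: prob_space "layer_space n" by (rule prob_space_layer_space)
  define T where "T = (\<Sum>e\<in>?E. (\<theta> e)\<^sup>2)"
  have gm: "(\<lambda>x. g (edge_gap e x)) \<in> borel_measurable (layer_space n)" if "e \<in> ?E" for e
    using measurable_edge_gap[OF that] g(1) by (rule measurable_compose)
  have gb: "\<bar>g (edge_gap e x)\<bar> \<le> B" for e x using g(2) edge_gap_bounds by blast
  have "T \<ge> 0" unfolding T_def by (intro sum_nonneg) auto
  show ?thesis
  \<comment> \<open>The central limit theorem requires positive variance; for \<open>T = 0\<close>
    all coefficients vanish and the cosine is constant.\<close>
  proof (cases "T = 0")
    case True
    then have "\<theta> e = 0" if "e \<in> ?E" for e
      using that fin by (auto simp: T_def sum_nonneg_eq_0_iff)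
    then have "(\<Sum>e\<in>?E. \<theta> e * S d e \<omega>) = 0" for d \<omega> by simp
    then show ?thesis using True by (simp add: T_def coord.prob_space)
  next
    case False
    with \<open>T \<ge> 0\<close> have T: "T > 0" by simp
    define F where "F x = (\<Sum>e\<in>?E. \<theta> e * g (edge_gap e x))" for x
    have Fm[measurable]: "F \<in> borel_measurable (layer_space n)"
      unfolding F_def[abs_def] by (intro borel_measurable_sum borel_measurable_times gm) auto
    have Fb: "\<bar>F x\<bar> \<le> (\<Sum>e\<in>?E. \<bar>\<theta> e\<bar> * B)" for x
      unfolding F_def by (rule order_trans[OF sum_abs]) (auto intro!: sum_mono mult_left_mono gb simp: abs_mult)
    have ig: "integrable (layer_space n) (\<lambda>x. g (edge_gap e x))" if "e \<in> ?E" for e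
      using gb gm[OF that] by (intro N.integrable_const_bound[where B = B]) auto
    have igg: "integrable (layer_space n) (\<lambda>x. g (edge_gap e x) * g (edge_gap e' x))"
      if "e \<in> ?E" "e' \<in> ?E" for e e'
    proof (rule N.integrable_const_bound[where B = "B * B"])
      have "\<bar>g (edge_gap e x)\<bar> * \<bar>g (edge_gap e' x)\<bar> \<le> B * B" for x
        using gb[of e x] gb[of e' x] by (intro mult_mono) auto
      then show "AE x in layer_space n. norm (g (edge_gap e x) * g (edge_gap e' x)) \<le> B * B"
        by (simp add: abs_mult)
    qed (use gm that in measurable)
    have F0: "N.expectation F = 0"
    proof -
      have "N.expectation F = (\<Sum>e\<in>?E. \<theta> e * N.expectation (\<lambda>x. g (edge_gap e x)))"
        unfolding F_def[abs_def] using ig by (subst Bochner_Integration.integral_sum) auto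
      then show ?thesis using integral_edge_gap[OF _ g] mean by simp
    qed
    have corr: "N.expectation (\<lambda>x. g (edge_gap e x) * g (edge_gap e' x)) = (if e = e' then 1 else 0)"
      if e: "e \<in> ?E" "e' \<in> ?E" for e e'
    proof (cases "e = e'")
      case True
      have "\<bar>(g z)\<^sup>2\<bar> \<le> B\<^sup>2" if "0 \<le> z" "z \<le> 1 / 2" for z
        using g(2)[OF that] by (simp add: abs_le_square_iff[symmetric])
      then show ?thesis
        using True integral_edge_gap[OF e(1), of "\<lambda>z. (g z)\<^sup>2" "B\<^sup>2"] g(1) var
        by (simp add: power2_eq_square)
    next
      case False
      then show ?thesis using integral_edge_gap_mult[OF e False g g] mean by simp
    qed
    have F2: "N.expectation (\<lambda>x. (F x)\<^sup>2) = T"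
    proof -
      have "N.expectation (\<lambda>x. (F x)\<^sup>2)
        = N.expectation (\<lambda>x. \<Sum>e\<in>?E. \<Sum>e'\<in>?E. \<theta> e * \<theta> e' * (g (edge_gap e x) * g (edge_gap e' x)))"
        by (intro Bochner_Integration.integral_cong)
           (auto simp: F_def power2_eq_square sum_product algebra_simps)
      also have "\<dots> = (\<Sum>e\<in>?E. \<Sum>e'\<in>?E. \<theta> e * \<theta> e' * N.expectation (\<lambda>x. g (edge_gap e x) * g (edge_gap e' x)))"
        using igg by (subst Bochner_Integration.integral_sum, fastforce intro!: Bochner_Integration.integrable_sum)
          (auto intro!: sum.cong simp: Bochner_Integration.integral_sum)
      also have "\<dots> = (\<Sum>e\<in>?E. \<Sum>e'\<in>?E. if e = e' then \<theta> e * \<theta> e' else 0)"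
        using corr by (intro sum.cong refl) auto
      also have "\<dots> = T" using fin by (simp add: T_def power2_eq_square)
      finally show ?thesis .
    qed
    define X where "X i \<omega> = F (layer n i \<omega>)" for i \<omega>
    have tr: "coord.expectation (\<lambda>\<omega>. f (layer n i \<omega>)) = N.expectation f"
      if "f \<in> borel_measurable (layer_space n)" for f :: "_ \<Rightarrow> real" and i
      using integral_distr[OF measurable_layer that, of i] unfolding distr_layer by simp
    have Xm[measurable]: "X i \<in> borel_measurable coord_space" for i
      unfolding X_def[abs_def] by measurable
    have EX: "coord.expectation (X i) = 0" for i
      unfolding X_def[abs_def] using tr[OF Fm] F0 by simp
    have "weak_conv_m (\<lambda>d. distr coord_space borel (\<lambda>\<omega>. (\<Sum>i<d. X i \<omega>) / sqrt (d * (sqrt T)\<^sup>2))) std_normal_distribution"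
    proof (rule coord.central_limit_theorem_zero_mean)
      show "coord.indep_vars (\<lambda>_. borel) X UNIV"
        unfolding X_def[abs_def] using indep_layers by (rule coord.indep_vars_compose2) (rule Fm)
      show "coord.expectation (X i) = 0" for i by (rule EX)
      show "0 < sqrt T" using T by simp
      show "integrable coord_space (\<lambda>\<omega>. (X i \<omega>)\<^sup>2)" for i
      proof (rule coord.integrable_const_bound[where B = "(\<Sum>e\<in>?E. \<bar>\<theta> e\<bar> * B)\<^sup>2"])
        have "(X i \<omega>)\<^sup>2 \<le> (\<Sum>e\<in>?E. \<bar>\<theta> e\<bar> * B)\<^sup>2" for \<omega>
          unfolding X_def using Fb by (simp add: abs_le_square_iff[symmetric] order_trans[OF Fb])
        then show "AE \<omega> in coord_space. norm ((X i \<omega>)\<^sup>2) \<le> (\<Sum>e\<in>?E. \<bar>\<theta> e\<bar> * B)\<^sup>2" by simp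
      qed simp
      show "coord.variance (X i) = (sqrt T)\<^sup>2" for i
        using tr[OF borel_measurable_power[OF Fm, of 2], of i] F2 \<open>T \<ge> 0\<close> by (simp add: EX) (simp add: X_def)
      show "distr coord_space borel (X i) = distr (layer_space n) borel F" for i
        using distr_distr[OF Fm measurable_layer, of i] unfolding distr_layer X_def[abs_def] comp_def by (rule sym)
    qed
    \<comment> \<open>Evaluating at \<open>sqrt T\<close> cancels the standardization by the
      deviation \<open>sqrt T\<close> and leaves the linear combination itself.\<close>
    then have "(\<lambda>d. char (distr coord_space borel (\<lambda>\<omega>. (\<Sum>i<d. X i \<omega>) / sqrt (d * (sqrt T)\<^sup>2))) (sqrt T))
        \<longlonglongrightarrow> char std_normal_distribution (sqrt T)"
      by (intro levy_continuity1 real_dist_normal_dist coord.real_distribution_distr) auto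
    moreover have "char (distr coord_space borel (\<lambda>\<omega>. (\<Sum>i<d. X i \<omega>) / sqrt (d * (sqrt T)\<^sup>2))) (sqrt T)
        = (CLINT \<omega>|coord_space. iexp (\<Sum>e\<in>?E. \<theta> e * S d e \<omega>))" for d
    proof -
      have "(\<Sum>i<d. X i \<omega>) = (\<Sum>e\<in>?E. \<theta> e * (\<Sum>i<d. g (edge_gap e (layer n i \<omega>))))" for \<omega>
        unfolding X_def F_def by (subst sum.swap) (simp add: sum_distrib_left)
      then have eq: "sqrt T * ((\<Sum>i<d. X i \<omega>) / sqrt (d * (sqrt T)\<^sup>2)) = (\<Sum>e\<in>?E. \<theta> e * S d e \<omega>)" for \<omega>
        using T by (simp add: S_def real_sqrt_mult sum_divide_distrib[symmetric])
      have "char (distr coord_space borel (\<lambda>\<omega>. (\<Sum>i<d. X i \<omega>) / sqrt (d * (sqrt T)\<^sup>2))) (sqrt T)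
        = (CLINT \<omega>|coord_space. iexp (sqrt T * ((\<Sum>i<d. X i \<omega>) / sqrt (d * (sqrt T)\<^sup>2))))"
        unfolding char_def by (rule integral_distr) measurable
      then show ?thesis by (simp only: eq)
    qed
    \<comment> \<open>Multiplying by \<open>iexp b\<close> and taking real parts introduces the
      phase \<open>b\<close> of the cosine.\<close>
    ultimately have "(\<lambda>d. Re (iexp b * (CLINT \<omega>|coord_space. iexp (\<Sum>e\<in>?E. \<theta> e * S d e \<omega>))))
        \<longlonglongrightarrow> Re (iexp b * complex_of_real (exp (- T / 2)))"
      using \<open>T \<ge> 0\<close> by (intro tendsto_intros) (simp add: char_std_normal_distribution)
    moreover have "Re (iexp b * (CLINT \<omega>|coord_space. iexp (\<Sum>e\<in>?E. \<theta> e * S d e \<omega>)))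
        = coord.expectation (\<lambda>\<omega>. cos ((\<Sum>e\<in>?E. \<theta> e * S d e \<omega>) + b))" for d
    proof -
      have Sm: "S d e \<in> borel_measurable coord_space" if "e \<in> ?E" for e
        unfolding S_def using that measurable_compose[OF measurable_edge_gap_layer[OF that] g(1)] by measurable
      have [measurable]: "(\<lambda>\<omega>. \<Sum>e\<in>?E. \<theta> e * S d e \<omega>) \<in> borel_measurable coord_space"
        by (intro borel_measurable_sum borel_measurable_times Sm) auto
      have i: "integrable coord_space (\<lambda>\<omega>. iexp b * iexp (\<Sum>e\<in>?E. \<theta> e * S d e \<omega>))"
        by (intro coord.integrable_const_bound[where B = 1]) (simp add: norm_mult del: of_real_sum of_real_mult, measurable)
      have "Re (iexp b * (CLINT \<omega>|coord_space. iexp (\<Sum>e\<in>?E. \<theta> e * S d e \<omega>)))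
        = Re (CLINT \<omega>|coord_space. iexp b * iexp (\<Sum>e\<in>?E. \<theta> e * S d e \<omega>))"
        by simp
      also have "\<dots> = coord.expectation (\<lambda>\<omega>. Re (iexp b * iexp (\<Sum>e\<in>?E. \<theta> e * S d e \<omega>)))"
        using i by (rule integral_Re[symmetric])
      also have "\<dots> = coord.expectation (\<lambda>\<omega>. cos ((\<Sum>e\<in>?E. \<theta> e * S d e \<omega>) + b))"
        by (intro Bochner_Integration.integral_cong refl)
           (simp add: Re_exp Im_exp cos_add del: of_real_sum)
      finally show ?thesis .
    qed
    ultimately show ?thesis by (simp add: T_def Re_exp)
  qed
qed

section \<open>Joint levels of the distances\<close>

lemma powr_root_le_iff:
  fixes x r t :: real
  assumes "0 \<le> x" "0 < r"
  shows "x powr (1 / r) \<le> t \<longleftrightarrow> x \<le> (if t < 0 then - 1 else t powr r)"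
proof (cases "t < 0")
  \<comment> \<open>A root is never below a negative threshold; the level \<open>- 1\<close>
    expresses this impossible event, as \<open>x\<close> is nonnegative.\<close>
  case True
  then have "\<not> x powr (1 / r) \<le> t" using powr_ge_zero[of x "1 / r"] by linarith
  then show ?thesis using True assms by auto
next
  case False
  have "x powr (1 / r) \<le> t" if "x \<le> t powr r"
    using powr_mono2[OF _ assms(1) that, of "1 / r"] False assms(2) by (simp add: powr_powr)
  moreover have "x \<le> t powr r" if "x powr (1 / r) \<le> t"
    using powr_mono2[OF _ _ that, of r] assms by (simp add: powr_powr)
  ultimately show ?thesis using False by auto
qed

text \<open>Only positivity of the variance needs an argument. If it vanished, the gap would almost
  surely equal \<open>m powr (1 / r)\<close>, confining a uniform point to at most two positions on
  the circle, which is a null set.\<close>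

lemma circle_gap_powr_standardization:
  fixes r :: real
  assumes r: "0 < r"
  obtains m s where "s > 0"
    "(\<integral>y. (circle_gap y 0 powr r - m) / s \<partial>unit_uniform) = 0"
    "(\<integral>y. ((circle_gap y 0 powr r - m) / s)\<^sup>2 \<partial>unit_uniform) = 1"
proof -
  interpret U: prob_space unit_uniform by (rule prob_space_unit_uniform)
  let ?f = "\<lambda>y. circle_gap y 0 powr r"
  define m where "m = integral\<^sup>L unit_uniform ?f"
  define v where "v = (\<integral>y. (?f y - m)\<^sup>2 \<partial>unit_uniform)"
  have f: "0 \<le> ?f y" "?f y \<le> 1" for y
    using circle_gap_bounds[of y 0] r by (auto intro!: powr_le1)
  have if1: "integrable unit_uniform ?f"
    using f by (intro U.integrable_const_bound[where B = 1]) auto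
  have if2: "integrable unit_uniform (\<lambda>y. (?f y - m)\<^sup>2)"
  proof (rule U.integrable_const_bound[where B = "(1 + \<bar>m\<bar>)\<^sup>2"])
    have "\<bar>?f y - m\<bar> \<le> \<bar>1 + \<bar>m\<bar>\<bar>" for y using f[of y] by linarith
    then show "AE y in unit_uniform. norm ((?f y - m)\<^sup>2) \<le> (1 + \<bar>m\<bar>)\<^sup>2"
      by (simp only: abs_le_square_iff norm_power real_norm_def power2_abs) simp
  qed measurable
  have "v \<noteq> 0"
  proof
    assume "v = 0"
    then have z: "AE y in unit_uniform. (?f y - m)\<^sup>2 = 0"
      using if2 unfolding v_def by (subst (asm) integral_nonneg_eq_0_iff_AE) auto
    have ne: "AE y in unit_uniform. y \<noteq> c" for c :: real
      using AE_lborel_singleton[of c] by (intro AE_uniform_measureI) auto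
    have "AE y in unit_uniform. False"
      using z AE_unit_uniform ne[of "m powr (1 / r)"] ne[of "1 - m powr (1 / r)"]
    proof eventually_elim
      case (elim y)
      then have "m powr (1 / r) = circle_gap y 0"
        using r circle_gap_bounds(1)[of y 0] by (auto simp: powr_powr)
      then show ?case using elim by (auto simp: circle_gap_eq_circle_dist circle_dist_def min_def split: if_splits)
    qed
    then show False by simp
  qed
  moreover have "0 \<le> v" unfolding v_def by (intro integral_nonneg_AE) auto
  ultimately have v: "v > 0" by simp
  show thesis
  proof
    show "sqrt v > 0" using v by simp
    show "(\<integral>y. (?f y - m) / sqrt v \<partial>unit_uniform) = 0"
      using if1 by (simp add: m_def[symmetric])
    show "(\<integral>y. ((?f y - m) / sqrt v)\<^sup>2 \<partial>unit_uniform) = 1"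
      using v by (simp add: power_divide v_def[symmetric])
  qed
qed

lemma root_levels_tendsto:
  fixes r :: real and t :: "nat \<Rightarrow> nat set \<Rightarrow> real"
  defines "D \<equiv> \<lambda>n d e \<omega>. (\<Sum>i<d. edge_gap e (layer n i \<omega>) powr r) powr (1 / r)"
  assumes r: "0 < r" and A: "A \<subseteq> vertex_pairs n"
    and q: "\<And>e. e \<in> vertex_pairs n \<Longrightarrow> 0 \<le> q e" "\<And>e. e \<in> vertex_pairs n \<Longrightarrow> q e \<le> 1"
      "\<And>d e. 1 \<le> d \<Longrightarrow> e \<in> vertex_pairs n \<Longrightarrow>
        coord.prob {\<omega> \<in> space coord_space. D n d e \<omega> \<le> t d e} = q e"
  shows "(\<lambda>d. coord.prob {\<omega> \<in> space coord_space. \<forall>e\<in>A. D n d e \<omega> \<le> t d e}) \<longlonglongrightarrow> (\<Prod>e\<in>A. q e)"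
proof -
  obtain m s where ms: "s > 0" "(\<integral>y. (circle_gap y 0 powr r - m) / s \<partial>unit_uniform) = 0"
    "(\<integral>y. ((circle_gap y 0 powr r - m) / s)\<^sup>2 \<partial>unit_uniform) = 1"
    using circle_gap_powr_standardization[OF r] by blast
  define g where "g z = (z powr r - m) / s" for z :: real
  define S where "S d e \<omega> = (\<Sum>i<d. g (edge_gap e (layer n i \<omega>))) / sqrt (real d)" for d e \<omega>
  \<comment> \<open>The level of the power sum under the affine map
    \<open>x \<mapsto> (x - d * m) / (s * sqrt d)\<close> that standardizes the sum.\<close>
  define \<tau> where "\<tau> d e = ((if t d e < 0 then - 1 else t d e powr r) - real d * m) / s / sqrt (real d)" for d e
  have gm[measurable]: "g \<in> borel_measurable borel" unfolding g_def by measurable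
  have gb: "\<bar>g z\<bar> \<le> (1 + \<bar>m\<bar>) / s" if "0 \<le> z" "z \<le> 1 / 2" for z
  proof -
    have "z powr r \<le> 1" using that r by (intro powr_le1) auto
    then have "\<bar>z powr r - m\<bar> \<le> 1 + \<bar>m\<bar>" using powr_ge_zero[of z r] by linarith
    then show ?thesis using ms(1) by (simp add: g_def divide_right_mono)
  qed
  \<comment> \<open>Dimension 0 is excluded because division by \<open>sqrt 0\<close> makes both
    \<open>S\<close> and \<open>\<tau>\<close> zero there.\<close>
  have S: "S d e \<omega> \<le> \<tau> d e \<longleftrightarrow> D n d e \<omega> \<le> t d e" if "1 \<le> d" for d e \<omega>
  proof -
    let ?x = "\<Sum>i<d. edge_gap e (layer n i \<omega>) powr r"
    have "S d e \<omega> = (?x - real d * m) / s / sqrt (real d)"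
      by (simp add: S_def g_def sum_divide_distrib[symmetric] sum_subtractf)
    then have "S d e \<omega> \<le> \<tau> d e \<longleftrightarrow> ?x \<le> (if t d e < 0 then - 1 else t d e powr r)"
      using that ms(1) by (simp add: \<tau>_def divide_le_cancel mult_less_0_iff)
    also have "\<dots> \<longleftrightarrow> D n d e \<omega> \<le> t d e"
      unfolding D_def using r by (intro powr_root_le_iff[symmetric] sum_nonneg) auto
    finally show ?thesis .
  qed
  have "(\<lambda>d. coord.prob {\<omega> \<in> space coord_space. \<forall>e\<in>A. S d e \<omega> \<le> \<tau> d e}) \<longlonglongrightarrow> (\<Prod>e\<in>A. q e)"
  proof (rule coord.asymptotically_independent_levels[OF finite_vertex_pairs[of n] _ _ _ _ _ A])
    show "S d e \<in> borel_measurable coord_space" if "e \<in> vertex_pairs n" for d e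
      unfolding S_def[abs_def] using measurable_compose[OF measurable_edge_gap_layer[OF that] gm] by measurable
    show "(\<lambda>d. coord.expectation (\<lambda>x. cos ((\<Sum>e\<in>vertex_pairs n. \<theta> e * S d e x) + b)))
      \<longlonglongrightarrow> cos b * exp (- (\<Sum>e\<in>vertex_pairs n. (\<theta> e)\<^sup>2) / 2)" for \<theta> b
      unfolding S_def using ms(2,3) by (intro layer_sums_char_tendsto[OF gm gb]) (simp_all add: g_def)
    show "\<forall>\<^sub>F d in sequentially. coord.prob {x \<in> space coord_space. S d e x \<le> \<tau> d e} = q e"
      if "e \<in> vertex_pairs n" for e
      using eventually_ge_at_top[of 1] by eventually_elim (use S q(3) that in simp)
  qed (use q in auto)
  then show ?thesis
    by (rule Lim_transform_eventually) (use eventually_ge_at_top[of 1] in eventually_elim, simp add: S)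
qed

section \<open>Maximum norm: Bonferroni estimates and powers of one-layer probabilities\<close>

lemma prod_one_minus_ge:
  fixes b :: "'a \<Rightarrow> real"
  assumes "finite A" "\<And>e. e \<in> A \<Longrightarrow> 0 \<le> b e" "\<And>e. e \<in> A \<Longrightarrow> b e \<le> 1"
  shows "1 - (\<Sum>e\<in>A. b e) \<le> (\<Prod>e\<in>A. 1 - b e)"
  using assms
proof (induction A rule: finite_induct)
  case (insert a A)
  have "b a * (\<Prod>e\<in>A. 1 - b e) \<le> b a * 1"
    using insert.prems by (intro mult_left_mono prod_le_1) auto
  moreover have "1 - (\<Sum>e\<in>A. b e) \<le> (\<Prod>e\<in>A. 1 - b e)" using insert by auto
  ultimately show ?case using insert.hyps by (simp add: left_diff_distrib)
qed simp

text \<open>A new factor \<open>1 - b a\<close> adds the error \<open>b a * (1 - ?P)\<close>, which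
  the Weierstrass inequality just proved bounds by \<open>b a * ?S\<close>. The right side counts
  ordered pairs and so grows by twice this amount. The estimate serves both for indicators, as a
  Bonferroni inequality, and for their means.\<close>

lemma prod_one_minus_approx:
  fixes b :: "'a \<Rightarrow> real"
  assumes "finite A" "\<And>e. e \<in> A \<Longrightarrow> 0 \<le> b e" "\<And>e. e \<in> A \<Longrightarrow> b e \<le> 1"
  shows "\<bar>(\<Prod>e\<in>A. 1 - b e) - (1 - (\<Sum>e\<in>A. b e))\<bar> \<le> (\<Sum>e\<in>A. \<Sum>e'\<in>A - {e}. b e * b e')"
  using assms
proof (induction A rule: finite_induct)
  case (insert a A)
  let ?P = "\<Prod>e\<in>A. 1 - b e" and ?S = "\<Sum>e\<in>A. b e" and ?R = "\<Sum>e\<in>A. \<Sum>e'\<in>A - {e}. b e * b e'"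
  have IH: "\<bar>?P - (1 - ?S)\<bar> \<le> ?R" using insert by auto
  have P: "?P \<le> 1" using insert.prems by (intro prod_le_1) auto
  have W: "1 - ?S \<le> ?P" using insert.prems by (intro prod_one_minus_ge) (use insert.hyps in auto)
  have a: "0 \<le> b a" "b a \<le> 1" using insert.prems by auto
  have "(\<Sum>e'\<in>insert a A - {e}. b e * b e') = b e * b a + (\<Sum>e'\<in>A - {e}. b e * b e')" if "e \<in> A" for e
  proof -
    have "insert a A - {e} = insert a (A - {e})" using that insert.hyps by auto
    then show ?thesis using insert.hyps by simp
  qed
  then have "(\<Sum>e\<in>insert a A. \<Sum>e'\<in>insert a A - {e}. b e * b e') = b a * ?S + (?S * b a + ?R)"
    using insert.hyps by (simp add: sum.distrib sum_distrib_left sum_distrib_right)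
  moreover have "(1 - b a) * ?P - (1 - (b a + ?S)) = (?P - (1 - ?S)) + b a * (1 - ?P)"
    by (simp add: algebra_simps)
  moreover have "\<bar>b a * (1 - ?P)\<bar> \<le> b a * ?S"
    using P W a by (simp add: abs_mult mult_left_mono)
  moreover have "0 \<le> ?S * b a" using insert.prems by (intro mult_nonneg_nonneg sum_nonneg) auto
  ultimately show ?case using IH insert.hyps by simp
qed simp

text \<open>A maximum stays below a level iff every layer does, and the layers are i.i.d. The
  dimension is positive because \<open>Max\<close> is taken over a nonempty set.\<close>

lemma prob_max_levels:
  fixes t :: "nat set \<Rightarrow> real"
  assumes A: "A \<subseteq> vertex_pairs n" and d: "1 \<le> d"
  shows "coord.prob {\<omega> \<in> space coord_space. \<forall>e\<in>A. Max ((\<lambda>i. edge_gap e (layer n i \<omega>)) ` {..<d}) \<le> t e}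
    = (measure (layer_space n) {x \<in> space (layer_space n). \<forall>e\<in>A. edge_gap e x \<le> t e}) ^ d"
proof -
  let ?B = "{x \<in> space (layer_space n). \<forall>e\<in>A. edge_gap e x \<le> t e}"
  have "finite A" using A finite_vertex_pairs by (rule finite_subset)
  then have B: "?B \<in> sets (layer_space n)"
    using A measurable_edge_gap by (intro sets.sets_Collect_finite_All) (auto intro!: borel_measurable_le)
  have "Max ((\<lambda>i. edge_gap e (layer n i \<omega>)) ` {..<d}) \<le> t e \<longleftrightarrow> (\<forall>i<d. edge_gap e (layer n i \<omega>) \<le> t e)" for e \<omega>
    using d by (subst Max_le_iff) (auto simp: lessThan_empty_iff)
  then have "{\<omega> \<in> space coord_space. \<forall>e\<in>A. Max ((\<lambda>i. edge_gap e (layer n i \<omega>)) ` {..<d}) \<le> t e}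
    = (\<Inter>i\<in>{..<d}. layer n i -` ?B \<inter> space coord_space)"
    using d measurable_space[OF measurable_layer] by (auto simp: lessThan_empty_iff)
  moreover have "coord.prob (\<Inter>i\<in>{..<d}. layer n i -` ?B \<inter> space coord_space)
    = (\<Prod>i<d. coord.prob (layer n i -` ?B \<inter> space coord_space))"
    using d B by (intro coord.indep_varsD[OF indep_layers]) (auto simp: lessThan_empty_iff)
  moreover have "coord.prob (layer n i -` ?B \<inter> space coord_space) = measure (layer_space n) ?B" for i
    using measure_distr[OF measurable_layer B, of i] unfolding distr_layer by simp
  ultimately show ?thesis by simp
qed

text \<open>Both quantities are compared with \<open>1 - (\<Sum>e\<in>A. \<delta> e)\<close>, which
  accounts for the factor 2. For the probability, the Bonferroni inequality is integrated, and
  pairwise independence evaluates the expected remainder as the same double sum that bounds the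
  error of the product.\<close>

lemma layer_levels_approx:
  fixes t :: "nat set \<Rightarrow> real"
  assumes A: "A \<subseteq> vertex_pairs n"
  defines "\<delta> \<equiv> \<lambda>e. 1 - measure (layer_space n) {x \<in> space (layer_space n). edge_gap e x \<le> t e}"
  shows "\<bar>measure (layer_space n) {x \<in> space (layer_space n). \<forall>e\<in>A. edge_gap e x \<le> t e} - (\<Prod>e\<in>A. 1 - \<delta> e)\<bar>
    \<le> 2 * (\<Sum>e\<in>A. \<Sum>e'\<in>A - {e}. \<delta> e * \<delta> e')"
proof -
  interpret N: prob_space "layer_space n" by (rule prob_space_layer_space)
  have fin: "finite A" using A finite_vertex_pairs by (rule finite_subset)
  \<comment> \<open>\<open>h e\<close> marks a gap beyond the threshold, so the product of the
    \<open>1 - h e\<close> is the indicator that all gaps in \<open>A\<close> stay within their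
    thresholds.\<close>
  define h where "h e = (indicator {t e<..} :: real \<Rightarrow> real)" for e
  have hm: "h e \<in> borel_measurable borel" for e unfolding h_def by measurable
  have hb: "\<bar>h e z\<bar> \<le> 1" "0 \<le> h e z" "h e z \<le> 1" for e z by (auto simp: h_def indicator_def)
  have hgm: "(\<lambda>x. h e (edge_gap e x)) \<in> borel_measurable (layer_space n)" if "e \<in> A" for e
    using that A by (intro measurable_compose[OF measurable_edge_gap hm]) auto
  have ih: "integrable (layer_space n) (\<lambda>x. h e (edge_gap e x))" if "e \<in> A" for e
    using hgm[OF that] hb by (intro N.integrable_const_bound[where B = 1]) auto
  have ihh: "integrable (layer_space n) (\<lambda>x. h e (edge_gap e x) * h e' (edge_gap e' x))" if "e \<in> A" "e' \<in> A" for e e'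
    using hgm[OF that(1)] hgm[OF that(2)] hb
    by (intro N.integrable_const_bound[where B = 1]) (auto simp: abs_mult intro!: mult_le_one)
  have sets: "{x \<in> space (layer_space n). edge_gap e x \<le> t e} \<in> N.events" if "e \<in> A" for e
    using that A measurable_edge_gap[of e n] by (auto intro!: borel_measurable_le)
  have Eh: "N.expectation (\<lambda>x. h e (edge_gap e x)) = \<delta> e" if "e \<in> A" for e
  proof -
    have "N.expectation (\<lambda>x. h e (edge_gap e x)) = N.expectation (indicator (space (layer_space n) - {x \<in> space (layer_space n). edge_gap e x \<le> t e}))"
      by (intro Bochner_Integration.integral_cong refl) (auto simp: h_def indicator_def)
    also have "\<dots> = N.prob (space (layer_space n) - {x \<in> space (layer_space n). edge_gap e x \<le> t e})"
      by (subst Bochner_Integration.integral_indicator) (intro arg_cong[where f = N.prob], blast)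
    finally show ?thesis using N.prob_compl[OF sets[OF that]] by (simp add: \<delta>_def)
  qed
  have Ehh: "N.expectation (\<lambda>x. h e (edge_gap e x) * h e' (edge_gap e' x)) = \<delta> e * \<delta> e'"
    if e: "e \<in> A" "e' \<in> A" "e \<noteq> e'" for e e'
  proof -
    have E: "e \<in> vertex_pairs n" "e' \<in> vertex_pairs n" using e A by auto
    show ?thesis
      using integral_edge_gap_mult[OF E e(3) hm hb(1) hm hb(1), of e e']
        integral_edge_gap[OF E(1) hm hb(1), of e] integral_edge_gap[OF E(2) hm hb(1), of e'] Eh e
      by simp
  qed
  let ?P = "\<lambda>x. \<Prod>e\<in>A. 1 - h e (edge_gap e x)"
  let ?R = "\<lambda>x. \<Sum>e\<in>A. \<Sum>e'\<in>A - {e}. h e (edge_gap e x) * h e' (edge_gap e' x)"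
  let ?Q = "\<Sum>e\<in>A. \<Sum>e'\<in>A - {e}. \<delta> e * \<delta> e'"
  have iP: "integrable (layer_space n) ?P"
  proof (rule N.integrable_const_bound[where B = 1])
    show "AE x in layer_space n. norm (?P x) \<le> 1"
      using hb by (auto simp: abs_prod intro!: prod_le_1)
  qed (use hgm in \<open>intro borel_measurable_prod borel_measurable_diff, auto\<close>)
  have iS: "integrable (layer_space n) (\<lambda>x. \<Sum>e\<in>A. h e (edge_gap e x))" using ih by auto
  have iR: "integrable (layer_space n) ?R" using ihh by (intro Bochner_Integration.integrable_sum) auto
  have P: "N.expectation ?P = N.prob {x \<in> space (layer_space n). \<forall>e\<in>A. edge_gap e x \<le> t e}"
  proof -
    have "N.expectation ?P = N.expectation (indicator {x \<in> space (layer_space n). \<forall>e\<in>A. edge_gap e x \<le> t e})"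
    proof (intro Bochner_Integration.integral_cong refl)
      fix x assume "x \<in> space (layer_space n)"
      moreover have "?P x = (\<Prod>e\<in>A. if edge_gap e x \<le> t e then 1 else 0)"
        by (intro prod.cong) (auto simp: h_def)
      ultimately show "?P x = indicator {x \<in> space (layer_space n). \<forall>e\<in>A. edge_gap e x \<le> t e} x"
        using fin by (auto simp: indicator_def)
    qed
    also have "\<dots> = N.prob {x \<in> space (layer_space n). \<forall>e\<in>A. edge_gap e x \<le> t e}"
      by (subst Bochner_Integration.integral_indicator) (intro arg_cong[where f = N.prob], blast)
    finally show ?thesis .
  qed
  have "N.expectation (\<lambda>x. ?P x - (1 - (\<Sum>e\<in>A. h e (edge_gap e x)))) = N.expectation ?P - (1 - (\<Sum>e\<in>A. \<delta> e))"
  proof -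
    have "N.expectation (\<lambda>x. \<Sum>e\<in>A. h e (edge_gap e x)) = (\<Sum>e\<in>A. \<delta> e)"
      using ih Eh by (subst Bochner_Integration.integral_sum) auto
    then show ?thesis using iP iS by (simp add: N.prob_space del: One_nat_def)
  qed
  moreover have "\<bar>N.expectation (\<lambda>x. ?P x - (1 - (\<Sum>e\<in>A. h e (edge_gap e x))))\<bar> \<le> N.expectation ?R"
  proof (rule order_trans[OF integral_abs_bound], rule integral_mono)
    show "integrable (layer_space n) (\<lambda>x. \<bar>?P x - (1 - (\<Sum>e\<in>A. h e (edge_gap e x)))\<bar>)"
      by (intro integrable_abs Bochner_Integration.integrable_diff iP iS N.integrable_const)
    show "\<bar>?P x - (1 - (\<Sum>e\<in>A. h e (edge_gap e x)))\<bar> \<le> ?R x" for x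
      by (rule prod_one_minus_approx) (use fin hb in auto)
  qed (rule iR)
  moreover have "N.expectation ?R = ?Q"
  proof -
    have "N.expectation ?R = (\<Sum>e\<in>A. N.expectation (\<lambda>x. \<Sum>e'\<in>A - {e}. h e (edge_gap e x) * h e' (edge_gap e' x)))"
      using ihh by (intro Bochner_Integration.integral_sum Bochner_Integration.integrable_sum) auto
    also have "\<dots> = (\<Sum>e\<in>A. \<Sum>e'\<in>A - {e}. N.expectation (\<lambda>x. h e (edge_gap e x) * h e' (edge_gap e' x)))"
      using ihh by (intro sum.cong refl Bochner_Integration.integral_sum) auto
    also have "\<dots> = ?Q" by (intro sum.cong refl Ehh) auto
    finally show ?thesis .
  qed
  moreover have "\<bar>(\<Prod>e\<in>A. 1 - \<delta> e) - (1 - (\<Sum>e\<in>A. \<delta> e))\<bar> \<le> ?Q"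
    by (rule prod_one_minus_approx) (use fin in \<open>auto simp: \<delta>_def simp del: One_nat_def\<close>)
  ultimately show ?thesis using P by linarith
qed

lemma max_levels_tendsto:
  fixes t :: "nat \<Rightarrow> nat set \<Rightarrow> real"
  defines "D \<equiv> \<lambda>n d e \<omega>. Max ((\<lambda>i. edge_gap e (layer n i \<omega>)) ` {..<d})"
  assumes A: "A \<subseteq> vertex_pairs n"
    and q: "\<And>e. e \<in> vertex_pairs n \<Longrightarrow> 0 < q e"
      "\<And>d e. 1 \<le> d \<Longrightarrow> e \<in> vertex_pairs n \<Longrightarrow>
        coord.prob {\<omega> \<in> space coord_space. D n d e \<omega> \<le> t d e} = q e"
  shows "(\<lambda>d. coord.prob {\<omega> \<in> space coord_space. \<forall>e\<in>A. D n d e \<omega> \<le> t d e}) \<longlonglongrightarrow> (\<Prod>e\<in>A. q e)"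
proof -
  interpret N: prob_space "layer_space n" by (rule prob_space_layer_space)
  let ?N = "layer_space n"
  define \<delta> where "\<delta> d e = 1 - N.prob {x \<in> space ?N. edge_gap e x \<le> t d e}" for d e
  \<comment> \<open>From \<open>(1 - \<delta> d e) ^ d = q e\<close> and
    \<open>ln (1 - x) \<le> - x\<close> follows \<open>d * \<delta> d e \<le> L e\<close>, a bound
    uniform in \<open>d\<close>; it is here that \<open>q e\<close> must be positive.\<close>
  define L where "L e = - ln (q e)" for e
  let ?K = "\<Sum>e\<in>A. \<Sum>e'\<in>A - {e}. L e * L e'"
  have \<delta>01: "0 \<le> \<delta> d e" "\<delta> d e \<le> 1" for d e by (auto simp: \<delta>_def simp del: One_nat_def)
  have q\<delta>: "(1 - \<delta> d e) ^ d = q e" if "1 \<le> d" "e \<in> A" for d e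
    using q(2)[of d e] prob_max_levels[of "{e}" n d "t d"] that A by (auto simp: D_def \<delta>_def)
  have d\<delta>: "real d * \<delta> d e \<le> L e" if "1 \<le> d" "e \<in> A" for d e
  proof -
    have "0 < q e" using q(1) that A by auto
    then have "1 - \<delta> d e \<noteq> 0" using q\<delta>[OF that] that(1) by (auto simp: power_0_left)
    then have pos: "0 < 1 - \<delta> d e" using \<delta>01[of d e] by linarith
    then have "ln (q e) = real d * ln (1 - \<delta> d e)" by (simp add: q\<delta>[OF that, symmetric] ln_realpow)
    also have "\<dots> \<le> real d * (- \<delta> d e)" using ln_le_minus_one[OF pos] by (intro mult_left_mono) auto
    finally show ?thesis by (simp add: L_def)
  qed
  \<comment> \<open>The uniform bound at \<open>d = 1\<close> squeezes \<open>\<delta> 1 e\<close>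
    between 0 and \<open>L e\<close>.\<close>
  have L0: "0 \<le> L e" if "e \<in> A" for e
    using d\<delta>[of 1 e] \<delta>01(1)[of 1 e] that by simp
  have bound: "\<bar>coord.prob {\<omega> \<in> space coord_space. \<forall>e\<in>A. D n d e \<omega> \<le> t d e} - (\<Prod>e\<in>A. q e)\<bar> \<le> 2 * ?K / real d"
    if d: "1 \<le> d" for d
  proof -
    let ?p = "N.prob {x \<in> space ?N. \<forall>e\<in>A. edge_gap e x \<le> t d e}"
    have "(\<Prod>e\<in>A. q e) = (\<Prod>e\<in>A. 1 - \<delta> d e) ^ d"
      using q\<delta>[OF d] by (simp add: prod_power_distrib)
    then have "\<bar>coord.prob {\<omega> \<in> space coord_space. \<forall>e\<in>A. D n d e \<omega> \<le> t d e} - (\<Prod>e\<in>A. q e)\<bar>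
      = norm (?p ^ d - (\<Prod>e\<in>A. 1 - \<delta> d e) ^ d)"
      using prob_max_levels[OF A d, of "t d"] by (simp add: D_def)
    \<comment> \<open>For numbers of modulus at most 1, taking \<open>d\<close>-th powers enlarges a
      difference at most by the factor \<open>d\<close>.\<close>
    also have "\<dots> \<le> real d * norm (?p - (\<Prod>e\<in>A. 1 - \<delta> d e))"
      using \<delta>01 by (intro norm_power_diff) (auto simp: abs_prod intro!: prod_le_1 simp del: One_nat_def)
    also have "\<dots> \<le> real d * (2 * (\<Sum>e\<in>A. \<Sum>e'\<in>A - {e}. \<delta> d e * \<delta> d e'))"
      using layer_levels_approx[OF A, of "t d"] by (intro mult_left_mono) (auto simp: \<delta>_def)
    \<comment> \<open>The error is quadratic in \<open>\<delta>\<close>: each of its two factors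
      absorbs one \<open>d\<close>, which leaves a spare \<open>1 / d\<close>.\<close>
    also have "\<dots> = 2 * (\<Sum>e\<in>A. \<Sum>e'\<in>A - {e}. (real d * \<delta> d e) * (real d * \<delta> d e')) / real d"
      using d by (simp add: sum_distrib_left sum_divide_distrib field_simps)
    also have "\<dots> \<le> 2 * ?K / real d"
      using d\<delta>[OF d] \<delta>01 L0 by (intro divide_right_mono mult_left_mono sum_mono mult_mono) auto
    finally show ?thesis .
  qed
  have "(\<lambda>d. coord.prob {\<omega> \<in> space coord_space. \<forall>e\<in>A. D n d e \<omega> \<le> t d e} - (\<Prod>e\<in>A. q e)) \<longlonglongrightarrow> 0"
  proof (rule Lim_null_comparison)
    show "\<forall>\<^sub>F d in sequentially. norm (coord.prob {\<omega> \<in> space coord_space. \<forall>e\<in>A. D n d e \<omega> \<le> t d e} - (\<Prod>e\<in>A. q e))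
      \<le> 2 * ?K / real d"
      using eventually_ge_at_top[of 1] by eventually_elim (simp add: bound)
    show "(\<lambda>d. 2 * ?K / real d) \<longlonglongrightarrow> 0"
      by (rule lim_const_over_n)
  qed
  then show ?thesis by (simp add: LIM_zero_iff)
qed

section \<open>Convergence of the random graph\<close>

text \<open>The counterpart of \<open>torus_dist\<close> on the common coordinate space, built from
  the periodic gap. The two agree only almost surely, since the space also contains points with
  coordinates outside \<open>[0, 1)\<close>.\<close>

definition layered_dist :: "nat \<Rightarrow> nat \<Rightarrow> ereal \<Rightarrow> nat set \<Rightarrow> (nat \<times> nat \<Rightarrow> real) \<Rightarrow> real" where
  "layered_dist n d p e \<omega> =
     (if p = \<infinity> then Max ((\<lambda>i. edge_gap e (layer n i \<omega>)) ` {..<d})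
      else (\<Sum>i<d. edge_gap e (layer n i \<omega>) powr real_of_ereal p) powr (1 / real_of_ereal p))"

lemma layered_levels_tendsto:
  fixes t :: "nat \<Rightarrow> nat set \<Rightarrow> real"
  assumes p: "1 \<le> p" and A: "A \<subseteq> vertex_pairs n"
    and q: "\<And>e. e \<in> vertex_pairs n \<Longrightarrow> 0 < q e" "\<And>e. e \<in> vertex_pairs n \<Longrightarrow> q e \<le> 1"
      "\<And>d e. 1 \<le> d \<Longrightarrow> e \<in> vertex_pairs n \<Longrightarrow>
        coord.prob {\<omega> \<in> space coord_space. layered_dist n d p e \<omega> \<le> t d e} = q e"
  shows "(\<lambda>d. coord.prob {\<omega> \<in> space coord_space. \<forall>e\<in>A. layered_dist n d p e \<omega> \<le> t d e})
    \<longlonglongrightarrow> (\<Prod>e\<in>A. q e)"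
proof (cases "p = \<infinity>")
  case True
  then show ?thesis
    using max_levels_tendsto[OF A, of q t] q by (simp add: layered_dist_def)
next
  case False
  then have "0 < real_of_ereal p" using p by (cases p) auto
  then show ?thesis
    using root_levels_tendsto[of "real_of_ereal p" A n q t] q A False by (simp add: layered_dist_def less_imp_le)
qed

definition coord_positions :: "nat \<Rightarrow> nat \<Rightarrow> (nat \<times> nat \<Rightarrow> real) \<Rightarrow> nat \<Rightarrow> nat \<Rightarrow> real" where
  "coord_positions n d \<omega> = (\<lambda>v\<in>{1..n}. \<lambda>i\<in>{..<d}. \<omega> (v, i))"

lemma measurable_coord_positions [measurable]:
  "coord_positions n d \<in> coord_space \<rightarrow>\<^sub>M positions n d"
  unfolding coord_positions_def[abs_def] positions_def torus_uniform_def by measurable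

lemma prob_space_positions: "prob_space (positions n d)"
  unfolding positions_def torus_uniform_def by (intro prob_space_PiM prob_space_unit_uniform)

lemma measurable_torus_dist:
  assumes "u \<in> {1..n}" "v \<in> {1..n}"
  shows "(\<lambda>x. torus_dist d p (x u) (x v)) \<in> borel_measurable (positions n d)"
proof -
  have coord: "(\<lambda>x. x w i) \<in> borel_measurable (positions n d)" if "w \<in> {1..n}" "i < d" for w i
  proof -
    have "(\<lambda>x. x w) \<in> positions n d \<rightarrow>\<^sub>M PiM {..<d} (\<lambda>_. unit_uniform)"
      unfolding positions_def torus_uniform_def using that(1) by (rule measurable_component_singleton)
    moreover have "(\<lambda>y. y i) \<in> PiM {..<d} (\<lambda>_. unit_uniform) \<rightarrow>\<^sub>M unit_uniform"
      using that(2) by (intro measurable_component_singleton) simp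
    ultimately have "(\<lambda>x. x w i) \<in> positions n d \<rightarrow>\<^sub>M unit_uniform" by (rule measurable_compose)
    then show ?thesis by (simp cong: measurable_cong_sets)
  qed
  have c: "(\<lambda>x. circle_dist (x u i) (x v i)) \<in> borel_measurable (positions n d)" if "i < d" for i
    unfolding circle_dist_def using coord[OF assms(1) that] coord[OF assms(2) that] by measurable
  show ?thesis
  proof (cases "p = \<infinity>")
    case True
    then show ?thesis unfolding torus_dist_def using c by (auto intro!: borel_measurable_Max)
  next
    case False
    have "(\<lambda>x. \<Sum>i<d. circle_dist (x u i) (x v i) powr real_of_ereal p) \<in> borel_measurable (positions n d)"
      using c by (intro borel_measurable_sum powr_real_measurable) auto
    then show ?thesis unfolding torus_dist_def using False by simp
  qed
qed

text \<open>There are countably many coordinates, so almost surely all of them lie in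
  \<open>[0, 1)\<close>, where \<open>circle_gap\<close> and \<open>circle_dist\<close>
  coincide.\<close>

lemma AE_torus_dist_eq_layered_dist:
  assumes "e \<in> vertex_pairs n"
  shows "AE \<omega> in coord_space.
    torus_dist d p (coord_positions n d \<omega> (Min e)) (coord_positions n d \<omega> (Max e)) = layered_dist n d p e \<omega>"
proof -
  have "AE \<omega> in coord_space. \<omega> k \<in> {0..<1}" for k
    by (rule AE_PiM_component[OF prob_space_unit_uniform _ AE_unit_uniform]) simp
  then have "AE \<omega> in coord_space. \<forall>k. \<omega> k \<in> {0..<1}" by (simp add: AE_all_countable)
  then show ?thesis
  proof eventually_elim
    case (elim \<omega>)
    from assms obtain u v where e: "e = {u, v}" "u \<in> {1..n}" "v \<in> {1..n}" "Min e = u" "Max e = v"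
      by (blast elim: vertex_pairsE)
    have "circle_dist (coord_positions n d \<omega> u i) (coord_positions n d \<omega> v i) = edge_gap e (layer n i \<omega>)"
      if "i < d" for i
      using that elim e by (simp add: edge_gap_pair coord_positions_def layer_def circle_gap_eq_circle_dist)
    then show ?case
      unfolding torus_dist_def layered_dist_def e(4,5) by (auto intro!: arg_cong[where f = Max])
  qed
qed

text \<open>Transfers events about the varying spaces \<open>positions n d\<close> to the single
  space on which the limits are taken. Singletons \<open>A\<close> carry over the threshold
  condition, general \<open>A\<close> the joint events.\<close>

lemma prob_positions_eq_prob_coord:
  assumes A: "A \<subseteq> vertex_pairs n"
  shows "measure (positions n d) {x \<in> space (positions n d). \<forall>e\<in>A. torus_dist d p (x (Min e)) (x (Max e)) \<le> s e}
    = coord.prob {\<omega> \<in> space coord_space. \<forall>e\<in>A. layered_dist n d p e \<omega> \<le> s e}"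
proof -
  let ?X = "{x \<in> space (positions n d). \<forall>e\<in>A. torus_dist d p (x (Min e)) (x (Max e)) \<le> s e}"
  have fin: "finite A" using A finite_vertex_pairs by (rule finite_subset)
  have X: "?X \<in> sets (positions n d)"
  proof (rule sets.sets_Collect_finite_All[OF _ fin])
    fix e assume "e \<in> A"
    then have "Min e \<in> {1..n}" "Max e \<in> {1..n}" using A by (blast elim: vertex_pairsE)+
    from measurable_torus_dist[OF this, of d p]
    show "{x \<in> space (positions n d). torus_dist d p (x (Min e)) (x (Max e)) \<le> s e} \<in> sets (positions n d)"
      by measurable
  qed
  have "measure (positions n d) ?X = coord.prob (coord_positions n d -` ?X \<inter> space coord_space)"
    using measure_distr[OF measurable_coord_positions X] distr_coord_positions[of n d]
    by (simp add: coord_positions_def[abs_def])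
  also have "\<dots> = coord.prob {\<omega> \<in> space coord_space. \<forall>e\<in>A. layered_dist n d p e \<omega> \<le> s e}"
  proof (rule measure_eq_AE)
    have "AE \<omega> in coord_space. \<forall>e\<in>A. torus_dist d p (coord_positions n d \<omega> (Min e)) (coord_positions n d \<omega> (Max e))
      = layered_dist n d p e \<omega>"
      using A AE_torus_dist_eq_layered_dist by (intro AE_finite_allI fin) auto
    then show "AE \<omega> in coord_space. \<omega> \<in> coord_positions n d -` ?X \<inter> space coord_space
      \<longleftrightarrow> \<omega> \<in> {\<omega> \<in> space coord_space. \<forall>e\<in>A. layered_dist n d p e \<omega> \<le> s e}"
      by eventually_elim (use measurable_space[OF measurable_coord_positions] in auto)
    show "coord_positions n d -` ?X \<inter> space coord_space \<in> coord.events"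
      using X by (rule measurable_sets[OF measurable_coord_positions])
    have "(\<lambda>\<omega>. layered_dist n d p e \<omega>) \<in> borel_measurable coord_space" if "e \<in> A" for e
    proof -
      have [measurable]: "(\<lambda>\<omega>. edge_gap e (layer n i \<omega>)) \<in> borel_measurable coord_space" for i
        using that A by (intro measurable_edge_gap_layer) auto
      show ?thesis
        unfolding layered_dist_def
        by (cases "p = \<infinity>") (simp_all add: borel_measurable_Max)
    qed
    then show "{\<omega> \<in> space coord_space. \<forall>e\<in>A. layered_dist n d p e \<omega> \<le> s e} \<in> coord.events"
      by (intro sets.sets_Collect_finite_All fin borel_measurable_le) auto
  qed
  finally show ?thesis .
qed

section \<open>From events about edge sets to laws of graphs\<close>

lemma edge_prob_bounds:
  assumes "lam > 0" "\<And>v. v \<in> {1..n} \<Longrightarrow> w v > 0" "u \<in> {1..n}" "v \<in> {1..n}"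
  shows "0 < edge_prob n lam w u v" "edge_prob n lam w u v \<le> 1"
  using assms by (auto simp: edge_prob_def)

lemma pmf_irg:
  assumes "lam > 0" "\<And>v. v \<in> {1..n} \<Longrightarrow> w v > 0" "H \<in> graphs n"
  shows "pmf (irg n lam w) H = (\<Prod>e\<in>H. edge_prob n lam w (Min e) (Max e))
    * (\<Prod>e\<in>vertex_pairs n - H. 1 - edge_prob n lam w (Min e) (Max e))"
proof -
  let ?E = "vertex_pairs n"
  let ?q = "\<lambda>e. edge_prob n lam w (Min e) (Max e)"
  let ?P = "Pi_pmf ?E False (\<lambda>e. bernoulli_pmf (?q e))"
  have H: "H \<subseteq> ?E" using assms(3) by (simp add: graphs_def)
  have q: "0 \<le> ?q e" "?q e \<le> 1" if "e \<in> ?E" for e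
    using that edge_prob_bounds[OF assms(1,2)] by (auto elim!: vertex_pairsE intro: less_imp_le)
  have "pmf (irg n lam w) H = measure_pmf.prob ?P ((\<lambda>b. {e \<in> ?E. b e}) -` {H})"
    by (simp add: irg_def pmf_map)
  also have "\<dots> = measure_pmf.prob ?P {\<lambda>e. e \<in> H}"
  proof (rule measure_eq_AE)
    \<comment> \<open>The preimage of \<open>H\<close> leaves the values outside \<open>?E\<close>
      free, but on the support of \<open>Pi_pmf\<close> these have the default \<open>False\<close>,
      so a single function remains.\<close>
    have "f = (\<lambda>e. e \<in> H) \<longleftrightarrow> {e \<in> ?E. f e} = H" if "f \<in> set_pmf ?P" for f
      using that H set_Pi_pmf_subset[OF finite_vertex_pairs[of n], of False "\<lambda>e. bernoulli_pmf (?q e)"]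
      by (auto simp: fun_eq_iff)
    then show "AE f in ?P. f \<in> (\<lambda>b. {e \<in> ?E. b e}) -` {H} \<longleftrightarrow> f \<in> {\<lambda>e. e \<in> H}"
      by (auto simp: AE_measure_pmf_iff)
  qed auto
  also have "\<dots> = pmf ?P (\<lambda>e. e \<in> H)" by (simp add: measure_pmf_single)
  also have "\<dots> = (\<Prod>e\<in>?E. pmf (bernoulli_pmf (?q e)) (e \<in> H))"
    using H by (intro pmf_Pi' finite_vertex_pairs) auto
  also have "\<dots> = (\<Prod>e\<in>?E - H. pmf (bernoulli_pmf (?q e)) (e \<in> H)) * (\<Prod>e\<in>H. pmf (bernoulli_pmf (?q e)) (e \<in> H))"
    using H by (intro prod.subset_diff finite_vertex_pairs)
  also have "\<dots> = (\<Prod>e\<in>?E - H. 1 - ?q e) * (\<Prod>e\<in>H. ?q e)"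
    using H q by (intro arg_cong2[where f = "(*)"] prod.cong) auto
  finally show ?thesis by simp
qed


text \<open>Inclusion-exclusion, one forbidden index at a time: forbidding \<open>b\<close>
  subtracts the probability of the pattern that requires \<open>b\<close>. The induction is
  therefore over \<open>B\<close> with \<open>A\<close> arbitrary.\<close>

lemma pattern_prob_tendsto:
  fixes Q :: "nat \<Rightarrow> 'e \<Rightarrow> 'b \<Rightarrow> bool" and N :: "nat \<Rightarrow> 'b measure"
  assumes N: "\<And>d. prob_space (N d)" and "finite E"
    and meas: "\<And>d e. e \<in> E \<Longrightarrow> {x \<in> space (N d). Q d e x} \<in> sets (N d)"
    and lim: "\<And>A. A \<subseteq> E \<Longrightarrow> (\<lambda>d. measure (N d) {x \<in> space (N d). \<forall>e\<in>A. Q d e x}) \<longlonglongrightarrow> (\<Prod>e\<in>A. q e :: real)"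
    and AB: "A \<subseteq> E" "B \<subseteq> E" "A \<inter> B = {}"
  shows "(\<lambda>d. measure (N d) {x \<in> space (N d). (\<forall>e\<in>A. Q d e x) \<and> (\<forall>e\<in>B. \<not> Q d e x)})
    \<longlonglongrightarrow> (\<Prod>e\<in>A. q e) * (\<Prod>e\<in>B. 1 - q e)"
  using finite_subset[OF AB(2) \<open>finite E\<close>] AB
proof (induction B arbitrary: A rule: finite_induct)
  case empty
  then show ?case using lim by simp
next
  case (insert b B)
  let ?S = "\<lambda>A B d. {x \<in> space (N d). (\<forall>e\<in>A. Q d e x) \<and> (\<forall>e\<in>B. \<not> Q d e x)}"
  have fin: "finite A" "finite B" using insert.prems \<open>finite E\<close> by (auto intro: finite_subset)
  have b: "b \<notin> A" "b \<in> E" using insert.prems by auto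
  have ev: "?S A B d \<in> sets (N d)" if "A \<subseteq> E" "finite A" for A d
    using that insert.prems fin meas
    by (intro sets.sets_Collect_conj sets.sets_Collect_finite_All sets.sets_Collect_neg) auto
  have "measure (N d) (?S A (insert b B) d) = measure (N d) (?S A B d) - measure (N d) (?S (insert b A) B d)" for d
  proof -
    interpret prob_space "N d" by (rule N)
    have "?S A (insert b B) d = ?S A B d - ?S (insert b A) B d" by auto
    moreover have "prob (?S A B d - ?S (insert b A) B d) = prob (?S A B d) - prob (?S (insert b A) B d)"
      using ev[of A d] ev[of "insert b A" d] insert.prems fin b by (intro finite_measure_Diff) auto
    ultimately show ?thesis by simp
  qed
  moreover have "(\<lambda>d. measure (N d) (?S A B d) - measure (N d) (?S (insert b A) B d))
    \<longlonglongrightarrow> (\<Prod>e\<in>A. q e) * (\<Prod>e\<in>B. 1 - q e) - (\<Prod>e\<in>insert b A. q e) * (\<Prod>e\<in>B. 1 - q e)"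
    using insert.prems insert.hyps b by (intro tendsto_diff insert.IH) auto
  moreover have "(\<Prod>e\<in>A. q e) * (\<Prod>e\<in>B. 1 - q e) - (\<Prod>e\<in>insert b A. q e) * (\<Prod>e\<in>B. 1 - q e)
    = (\<Prod>e\<in>A. q e) * (\<Prod>e\<in>insert b B. 1 - q e)"
    using fin b insert.hyps by (simp add: algebra_simps)
  ultimately show ?case by simp
qed

text \<open>\<open>girg_graph\<close> accepts a pair in either orientation; symmetry of the distance
  and of the thresholds makes the orientation by \<open>Min\<close> and \<open>Max\<close>
  decisive.\<close>

lemma mem_girg_graph_iff:
  assumes "girg_thresholds n lam w p d t" "e \<in> vertex_pairs n"
  shows "e \<in> girg_graph n p d t x \<longleftrightarrow> torus_dist d p (x (Min e)) (x (Max e)) \<le> t (Min e) (Max e)"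
proof -
  from assms(2) obtain u v where e: "e = {u, v}" "u \<in> {1..n}" "v \<in> {1..n}" "u < v" "Min e = u" "Max e = v"
    by (blast elim: vertex_pairsE)
  have "circle_dist a b = circle_dist b a" for a b by (simp add: circle_dist_def abs_minus_commute)
  then have "torus_dist d p (x v) (x u) = torus_dist d p (x u) (x v)" by (simp add: torus_dist_def)
  moreover have "t v u = t u v" using assms(1) e by (auto simp: girg_thresholds_def)
  ultimately have "e \<in> girg_graph n p d t x \<Longrightarrow> torus_dist d p (x u) (x v) \<le> t u v"
    unfolding girg_graph_def e(1) by (auto simp: doubleton_eq_iff)
  moreover have "torus_dist d p (x u) (x v) \<le> t u v \<Longrightarrow> e \<in> girg_graph n p d t x"
    unfolding girg_graph_def using e(1-4) by blast
  ultimately show ?thesis unfolding e(5,6) by blast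
qed

theorem theorem1:
  fixes n :: nat and lam :: real and w :: "nat \<Rightarrow> real" and p :: ereal
    and t :: "nat \<Rightarrow> nat \<Rightarrow> nat \<Rightarrow> real"
  assumes "lam > 0"
    and "\<And>v. v \<in> {1..n} \<Longrightarrow> w v > 0"
    and "1 \<le> p"
    and "\<And>d. d \<ge> 1 \<Longrightarrow> girg_thresholds n lam w p d (t d)"
  shows "(\<lambda>d. tv_dist n (girg n p d (t d)) (measure_pmf (irg n lam w))) \<longlonglongrightarrow> 0"
proof -
  let ?E = "vertex_pairs n"
  define q where "q e = edge_prob n lam w (Min e) (Max e)" for e
  define Q where "Q d e x \<longleftrightarrow> torus_dist d p (x (Min e)) (x (Max e)) \<le> t d (Min e) (Max e)" for d e x
  have E: "Min e \<in> {1..n}" "Max e \<in> {1..n}" "Min e \<noteq> Max e" if "e \<in> ?E" for e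
    using that by (auto elim!: vertex_pairsE)
  have q: "0 < q e" "q e \<le> 1" if "e \<in> ?E" for e
    using edge_prob_bounds[OF assms(1,2) E(1,2)[OF that]] by (auto simp: q_def)
  have meas: "{x \<in> space (positions n d). Q d e x} \<in> sets (positions n d)" if "e \<in> ?E" for d e
    unfolding Q_def using measurable_torus_dist[OF E(1,2)[OF that], of d p] by measurable
  \<comment> \<open>The threshold hypothesis supplies exactly the marginal probabilities
    \<open>q e\<close>; the joint limit is obtained on the coordinate space and carried
    back.\<close>
  have sub: "(\<lambda>d. measure (positions n d) {x \<in> space (positions n d). \<forall>e\<in>A. Q d e x}) \<longlonglongrightarrow> (\<Prod>e\<in>A. q e)"
    if A: "A \<subseteq> ?E" for A
  proof -
    have "coord.prob {\<omega> \<in> space coord_space. layered_dist n d p e \<omega> \<le> t d (Min e) (Max e)} = q e"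
      if "1 \<le> d" "e \<in> ?E" for d e
    proof -
      have "measure (positions n d) {x \<in> space (positions n d). torus_dist d p (x (Min e)) (x (Max e)) \<le> t d (Min e) (Max e)} = q e"
        using assms(4)[OF that(1)] E[OF that(2)] unfolding girg_thresholds_def q_def by blast
      then show ?thesis
        using prob_positions_eq_prob_coord[of "{e}" n d p "\<lambda>e. t d (Min e) (Max e)"] that(2) by simp
    qed
    then have "(\<lambda>d. coord.prob {\<omega> \<in> space coord_space. \<forall>e\<in>A. layered_dist n d p e \<omega> \<le> t d (Min e) (Max e)})
      \<longlonglongrightarrow> (\<Prod>e\<in>A. q e)"
      by (intro layered_levels_tendsto[OF assms(3) A] q)
    moreover have "measure (positions n d) {x \<in> space (positions n d). \<forall>e\<in>A. Q d e x}
      = coord.prob {\<omega> \<in> space coord_space. \<forall>e\<in>A. layered_dist n d p e \<omega> \<le> t d (Min e) (Max e)}" for d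
      unfolding Q_def by (rule prob_positions_eq_prob_coord[OF A])
    ultimately show ?thesis by simp
  qed
  \<comment> \<open>Since \<open>graphs n\<close> is finite, convergence of every point probability
    suffices for total variation. The event that the graph equals \<open>H\<close> prescribes each
    pair in \<open>?E\<close> as an edge or a non-edge.\<close>
  have lim: "(\<lambda>d. measure (girg n p d (t d)) {H}) \<longlonglongrightarrow> measure (measure_pmf (irg n lam w)) {H}"
    if H: "H \<in> graphs n" for H
  proof -
    have HE: "H \<subseteq> ?E" using H by (simp add: graphs_def)
    have "(\<lambda>d. measure (positions n d) {x \<in> space (positions n d). (\<forall>e\<in>H. Q d e x) \<and> (\<forall>e\<in>?E - H. \<not> Q d e x)})
      \<longlonglongrightarrow> (\<Prod>e\<in>H. q e) * (\<Prod>e\<in>?E - H. 1 - q e)"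
      using HE by (intro pattern_prob_tendsto[OF prob_space_positions finite_vertex_pairs[of n] meas sub]) auto
    also have "(\<Prod>e\<in>H. q e) * (\<Prod>e\<in>?E - H. 1 - q e) = measure (measure_pmf (irg n lam w)) {H}"
      using pmf_irg[OF assms(1,2) H] by (simp add: q_def measure_pmf_single)
    finally show ?thesis
    proof (rule Lim_transform_eventually)
      show "\<forall>\<^sub>F d in sequentially. measure (positions n d)
          {x \<in> space (positions n d). (\<forall>e\<in>H. Q d e x) \<and> (\<forall>e\<in>?E - H. \<not> Q d e x)} = measure (girg n p d (t d)) {H}"
        using eventually_ge_at_top[of 1]
      proof eventually_elim
        case (elim d)
        let ?G = "girg_graph n p d (t d)"
        have sub: "?G x \<subseteq> ?E" for x by (auto simp: girg_graph_def vertex_pairs_def)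
        have Q: "e \<in> ?G x \<longleftrightarrow> Q d e x" if "e \<in> ?E" for e x
          using mem_girg_graph_iff[OF assms(4)[OF elim] that] by (simp add: Q_def)
        have vimage: "?G -` {K} \<inter> space (positions n d)
          = {x \<in> space (positions n d). (\<forall>e\<in>K. Q d e x) \<and> (\<forall>e\<in>?E - K. \<not> Q d e x)}" if "K \<subseteq> ?E" for K
        proof -
          have "?G x = K \<longleftrightarrow> (\<forall>e\<in>?E. e \<in> ?G x \<longleftrightarrow> e \<in> K)" for x using that sub by blast
          then have "?G x = K \<longleftrightarrow> (\<forall>e\<in>?E. Q d e x \<longleftrightarrow> e \<in> K)" for x using Q by simp
          then show ?thesis using that by auto
        qed
        \<comment> \<open>Measurability is needed to evaluate the \<open>distr\<close> in
          \<open>girg\<close>; the target is finite, so it is enough that the preimage of each graph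
          is an event.\<close>
        have "?G \<in> positions n d \<rightarrow>\<^sub>M count_space (graphs n)"
        proof (subst measurable_count_space_eq2)
          show "finite (graphs n)" by (simp add: graphs_def finite_vertex_pairs)
          have "?G -` {K} \<inter> space (positions n d) \<in> sets (positions n d)" if "K \<subseteq> ?E" for K
            unfolding vimage[OF that] using that meas finite_vertex_pairs[of n]
            by (intro sets.sets_Collect_conj sets.sets_Collect_finite_All sets.sets_Collect_neg)
               (auto intro: finite_subset)
          then show "?G \<in> space (positions n d) \<rightarrow> graphs n
            \<and> (\<forall>a\<in>graphs n. ?G -` {a} \<inter> space (positions n d) \<in> sets (positions n d))"
            using sub by (auto simp: graphs_def)
        qed
        then have "measure (girg n p d (t d)) {H} = measure (positions n d) (?G -` {H} \<inter> space (positions n d))"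
          unfolding girg_def using H by (intro measure_distr) auto
        then show ?case by (simp add: vimage[OF HE])
      qed
    qed
  qed
  have "(\<lambda>d. tv_dist n (girg n p d (t d)) (measure_pmf (irg n lam w)))
    \<longlonglongrightarrow> 1 / 2 * (\<Sum>H\<in>graphs n. \<bar>measure (measure_pmf (irg n lam w)) {H} - measure (measure_pmf (irg n lam w)) {H}\<bar>)"
    unfolding tv_dist_def by (intro tendsto_intros lim)
  then show ?thesis by simp
qed

end
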